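(* For every integer $k\ge2$, let $G_{k,2}$ be the graph obtained from the complete graph on vertices $u_1,\dots,u_k$ by attaching two pendant leaves to each $u_i$. Then $G_{k,2}$ has $3k$ vertices and every exact optimal strategy $\mu\in\mathcal O(G_{k,2})$ of the first-passage location game satisfies $$\operatorname{supp}(\mu)=\{u_1,\dots,u_k\}.$$ Consequently $$\min_{\mu\in\mathcal O(G_{k,2})}|\operatorname{supp}(\mu)|=\max_{\mu\in\mathcal O(G_{k,2})}|\operatorname{supp}(\mu)|=k=\frac{|V(G_{k,2})|}{3}.$$
   Context: Walk: on a finite connected graph $G=(V,E)$ the constant-speed walk waits at each vertex an exponential time of mean one and then jumps to a uniformly random neighbor (so a leaf also has total jump rate one). Payoffs: for independent walks started at $a,b\in V$, let $\tau_z^{(a)},\tau_z^{(b)}$ be the first hitting times of $z\in V$ (equal to $0$ if the start is $z$), and set $$q_z(a,b)=\Pr(\tau_z^{(a)}<\tau_z^{(b)})+\tfrac12\Pr(\tau_z^{(a)}=\tau_z^{(b)}),\qquad U_G(a,b)=\sum_{z\in V}q_z(a,b),\qquad A_G(a,b)=U_G(a,b)-\tfrac{|V|}{2}.$$ Co-location is permitted, with the two walks independent given their common start. Optimal strategies: $$\mathcal O(G)=\Bigl\{\mu\in\mathcal P(V):\ \sum_{a\in V}\mu(a)A_G(a,b)\ge 0\ \text{ for every } b\in V\Bigr\},$$ where $\mathcal P(V)$ is the set of probability measures on $V$. *)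

theory Defs
  imports "HOL-Probability.Probability" "Graph_Theory.Pair_Digraph"
begin

text \<open>
  Finite simple graphs are the symmetric, loop-free pair digraphs of \<^locale>\<open>pair_graph\<close>: an
  edge between \<open>v\<close> and \<open>w\<close> is the pair of arcs \<open>(v, w)\<close> and \<open>(w, v)\<close>.
\<close>

definition neighbors :: "'v pair_pre_digraph \<Rightarrow> 'v \<Rightarrow> 'v set" where
  "neighbors G v = parcs G `` {v}"

subsection \<open>The constant-speed walk\<close>

text \<open>
  The walk is built from an i.i.d. sequence of steps.  A step \<open>(f, s)\<close> consists of independent
  uniform neighbours \<open>f v\<close>, one for each vertex \<open>v\<close>, and an independent exponential time \<open>s\<close> of
  mean one; if the walk is at \<open>v\<close> when it uses this step, it waits for time \<open>s\<close> and then jumps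
  to \<open>f v\<close>.  Only the arrow at the current position is ever used, so the jump chain and the
  holding times have the intended joint law; see \<open>jump_chain_holding\<close> below.
  On a graph with an isolated vertex the construction degenerates (an isolated vertex has no
  uniform neighbour).
\<close>

definition step_measure :: "'v pair_pre_digraph \<Rightarrow> (('v \<Rightarrow> 'v) \<times> real) measure" where
  "step_measure G =
     (\<Pi>\<^sub>M v\<in>pverts G. uniform_count_measure (neighbors G v)) \<Otimes>\<^sub>M
     density lborel (\<lambda>s. ennreal (exponential_density 1 s))"

definition walk_measure :: "'v pair_pre_digraph \<Rightarrow> (('v \<Rightarrow> 'v) \<times> real) stream measure" where
  "walk_measure G = stream_space (step_measure G)"

primrec jump_chain :: "'v \<Rightarrow> (('v \<Rightarrow> 'v) \<times> real) stream \<Rightarrow> nat \<Rightarrow> 'v" where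
  "jump_chain a \<omega> 0 = a"
| "jump_chain a \<omega> (Suc n) = fst (\<omega> !! n) (jump_chain a \<omega> n)"

text \<open>
  The walk makes its \<open>n\<close>-th jump at the sum of the first \<open>n\<close> holding times.  The choice of
  value at times at or after an accumulation point of the jump times is immaterial, because
  almost surely there is none.
\<close>

definition walk_at :: "'v \<Rightarrow> (('v \<Rightarrow> 'v) \<times> real) stream \<Rightarrow> real \<Rightarrow> 'v" where
  "walk_at a \<omega> t = jump_chain a \<omega> (LEAST n. t < (\<Sum>i\<le>n. snd (\<omega> !! i)))"

definition hitting_time :: "'v \<Rightarrow> 'v \<Rightarrow> (('v \<Rightarrow> 'v) \<times> real) stream \<Rightarrow> ereal" where
  "hitting_time z a \<omega> = Inf (ereal ` {t. 0 \<le> t \<and> walk_at a \<omega> t = z})"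

subsection \<open>The first-passage location game\<close>

text \<open>The product measure makes the two walks independent, also when \<open>a = b\<close>.\<close>

definition first_passage_prob :: "'v pair_pre_digraph \<Rightarrow> 'v \<Rightarrow> 'v \<Rightarrow> 'v \<Rightarrow> real" where
  "first_passage_prob G z a b =
     \<P>((\<omega>, \<omega>') in walk_measure G \<Otimes>\<^sub>M walk_measure G. hitting_time z a \<omega> < hitting_time z b \<omega>') +
     1/2 * \<P>((\<omega>, \<omega>') in walk_measure G \<Otimes>\<^sub>M walk_measure G. hitting_time z a \<omega> = hitting_time z b \<omega>')"

definition payoff :: "'v pair_pre_digraph \<Rightarrow> 'v \<Rightarrow> 'v \<Rightarrow> real" where
  "payoff G a b = (\<Sum>z\<in>pverts G. first_passage_prob G z a b)"

definition centered_payoff :: "'v pair_pre_digraph \<Rightarrow> 'v \<Rightarrow> 'v \<Rightarrow> real" where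
  "centered_payoff G a b = payoff G a b - real (card (pverts G)) / 2"

definition optimal_strategies :: "'v pair_pre_digraph \<Rightarrow> 'v pmf set" where
  "optimal_strategies G =
     {\<mu>. set_pmf \<mu> \<subseteq> pverts G \<and>
         (\<forall>b\<in>pverts G. (\<Sum>a\<in>pverts G. pmf \<mu> a * centered_payoff G a b) \<ge> 0)}"

subsection \<open>Complete graphs with pendant leaves\<close>

datatype pendant_vertex = Core nat | Leaf nat nat

text \<open>
  \<open>pendant_clique k l\<close> is the graph \<open>G\<^bsub>k,l\<^esub>\<close>: \<open>Core i\<close> is \<open>u\<^sub>i\<close>, and \<open>Leaf i j\<close> is the \<open>j\<close>-th
  of the \<open>l\<close> leaves at \<open>u\<^sub>i\<close>.
\<close>

definition pendant_clique :: "nat \<Rightarrow> nat \<Rightarrow> pendant_vertex pair_pre_digraph" where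
  "pendant_clique k l =
     \<lparr> pverts = {Core i | i. i \<in> {1..k}} \<union> {Leaf i j | i j. i \<in> {1..k} \<and> j \<in> {1..l}},
       parcs = {(Core i, Core j) | i j. i \<in> {1..k} \<and> j \<in> {1..k} \<and> i \<noteq> j} \<union>
               {(Core i, Leaf i j) | i j. i \<in> {1..k} \<and> j \<in> {1..l}} \<union>
               {(Leaf i j, Core i) | i j. i \<in> {1..k} \<and> j \<in> {1..l}} \<rparr>"

lemma pair_graph_pendant_clique: "pair_graph (pendant_clique k l)"
proof -
  have fin: "finite (pverts (pendant_clique k l))"
  proof (rule finite_subset)
    show "pverts (pendant_clique k l) \<subseteq> Core ` {1..k} \<union> case_prod Leaf ` ({1..k} \<times> {1..l})"
      by (auto simp: pendant_clique_def)
  qed auto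
  have sub: "parcs (pendant_clique k l) \<subseteq> pverts (pendant_clique k l) \<times> pverts (pendant_clique k l)"
    by (auto simp: pendant_clique_def)
  have "finite (parcs (pendant_clique k l))"
    using fin sub by (meson finite_SigmaI finite_subset)
  moreover have "sym (parcs (pendant_clique k l))"
    unfolding sym_def by (auto simp: pendant_clique_def)
  ultimately show ?thesis
    using fin sub by unfold_locales (auto simp: symmetric_def pendant_clique_def)
qed

subsection \<open>The law of the walk\<close>

lemma prob_space_step_measure:
  assumes "finite (pverts G)"
    and "\<And>v. v \<in> pverts G \<Longrightarrow> finite (neighbors G v) \<and> neighbors G v \<noteq> {}"
  shows "prob_space (step_measure G)"
proof -
  have "prob_space (PiM (pverts G) (\<lambda>v. uniform_count_measure (neighbors G v)))"
    by (rule prob_space_PiM) (use assms(2) in \<open>auto intro!: prob_space_uniform_count_measure\<close>)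
  moreover have "prob_space (density lborel (\<lambda>s. ennreal (exponential_density 1 s)))"
    by (rule prob_space_exponential_density) simp
  ultimately show ?thesis
    unfolding step_measure_def by (intro prob_space_pair)
qed

lemma jump_chain_Stream_Suc:
  "jump_chain a (x ## \<omega>) (Suc n) = jump_chain (fst x a) \<omega> n"
  by (induction n) auto

text \<open>
  From \<open>a\<close>, the probability that the first positions are \<open>y 0, \<dots>, y n\<close> and that the \<open>i\<close>-th
  holding time lies in \<open>B i\<close> for every \<open>i < n\<close>: uniform jumps to neighbours, and independent
  exponential holding times of mean one.
\<close>

lemma jump_chain_holding:
  fixes B :: "nat \<Rightarrow> real set" and n :: nat
  assumes fin: "finite (pverts G)"
    and nb: "\<And>v. v \<in> pverts G \<Longrightarrow>
               finite (neighbors G v) \<and> neighbors G v \<noteq> {} \<and> neighbors G v \<subseteq> pverts G"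
    and a: "a \<in> pverts G" and y0: "y 0 = a"
    and B: "\<And>i. B i \<in> sets borel"
  defines "E \<equiv> {\<omega> \<in> space (walk_measure G).
           (\<forall>i\<le>n. jump_chain a \<omega> i = y i) \<and> (\<forall>i<n. snd (\<omega> !! i) \<in> B i)}"
  shows "E \<in> sets (walk_measure G)"
    and "measure (walk_measure G) E =
         (\<Prod>i<n. (if y (Suc i) \<in> neighbors G (y i) then 1 / real (card (neighbors G (y i))) else 0) *
                  measure (density lborel (\<lambda>s. ennreal (exponential_density 1 s))) (B i))"
proof -
  define P where "P = (\<Pi>\<^sub>M v\<in>pverts G. uniform_count_measure (neighbors G v))"
  define H where "H = density lborel (\<lambda>s. ennreal (exponential_density 1 s))"
  define W where "W = stream_space (P \<Otimes>\<^sub>M H)"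
  have PH: "step_measure G = P \<Otimes>\<^sub>M H" and WW: "walk_measure G = W"
    by (auto simp: step_measure_def walk_measure_def P_def H_def W_def)
  interpret S: prob_space "P \<Otimes>\<^sub>M H"
    using prob_space_step_measure[OF fin] nb unfolding PH by blast
  have nbp: "prob_space (uniform_count_measure (neighbors G v))" if "v \<in> pverts G" for v
    using nb[OF that] by (intro prob_space_uniform_count_measure) auto
  interpret P: prob_space P
    unfolding P_def by (rule prob_space_PiM) (rule nbp)
  interpret H: prob_space H
    unfolding H_def by (rule prob_space_exponential_density) simp
  interpret PH: pair_prob_space P H ..
  interpret W: prob_space W
    unfolding W_def by (rule S.prob_space_stream_space)
  have setsH[simp]: "sets H = sets borel"
    by (simp add: H_def)
  define E' where "E' n a y B = {\<omega> \<in> space W.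
      (\<forall>i\<le>n. jump_chain a \<omega> i = y i) \<and> (\<forall>i<n. snd (\<omega> !! i) \<in> B i)}"
    for n a and y :: "nat \<Rightarrow> 'a" and B :: "nat \<Rightarrow> real set"
  have arrow: "{f \<in> space P. f v = w} \<in> sets P"
    "measure P {f \<in> space P. f v = w} = (if w \<in> neighbors G v then 1 / real (card (neighbors G v)) else 0)"
    if v: "v \<in> pverts G" for v w
  proof -
    have meas: "(\<lambda>f. f v) \<in> measurable P (uniform_count_measure (neighbors G v))"
      unfolding P_def using v by (rule measurable_component_singleton)
    have eq: "{f \<in> space P. f v = w} = (\<lambda>f. f v) -` ({w} \<inter> neighbors G v) \<inter> space P"
      using measurable_space[OF meas] by (auto simp: space_uniform_count_measure)
    show "{f \<in> space P. f v = w} \<in> sets P"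
      unfolding eq by (rule measurable_sets[OF meas]) (simp add: sets_uniform_count_measure)
    have "measure P {f \<in> space P. f v = w} =
        measure (distr P (uniform_count_measure (neighbors G v)) (\<lambda>f. f v)) ({w} \<inter> neighbors G v)"
      unfolding eq by (rule measure_distr[OF meas, symmetric]) (simp add: sets_uniform_count_measure)
    also have "distr P (uniform_count_measure (neighbors G v)) (\<lambda>f. f v) =
        uniform_count_measure (neighbors G v)"
      unfolding P_def using fin nbp v by (intro distr_PiM_component) auto
    also have "measure \<dots> ({w} \<inter> neighbors G v) = card ({w} \<inter> neighbors G v) / card (neighbors G v)"
      using nb[OF v] by (intro measure_uniform_count_measure) auto
    finally show "measure P {f \<in> space P. f v = w} =
        (if w \<in> neighbors G v then 1 / real (card (neighbors G v)) else 0)"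
      by auto
  qed
  have main: "E' n a y B \<in> sets W \<and> measure W (E' n a y B) =
      (\<Prod>i<n. (if y (Suc i) \<in> neighbors G (y i) then 1 / real (card (neighbors G (y i))) else 0) *
        measure H (B i))"
    if "a \<in> pverts G" "y 0 = a" "\<And>i. B i \<in> sets borel" for n a y B
    using that
  proof (induction n arbitrary: a y B)
    case 0
    then have "E' 0 a y B = space W"
      by (auto simp: E'_def)
    then show ?case
      by (simp add: W.prob_space)
  next
    case (Suc n)
    define U where "U = {f \<in> space P. f a = y (Suc 0)} \<times> B 0"
    define D where "D = E' n (y (Suc 0)) (\<lambda>i. y (Suc i)) (\<lambda>i. B (Suc i))"
    have Um: "U \<in> sets (P \<Otimes>\<^sub>M H)"
      unfolding U_def using arrow(1)[OF Suc.prems(1)] Suc.prems(3) by auto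
    have mU: "measure (P \<Otimes>\<^sub>M H) U =
        (if y (Suc 0) \<in> neighbors G a then 1 / real (card (neighbors G a)) else 0) * measure H (B 0)"
    proof -
      have "measure (P \<Otimes>\<^sub>M H) U = measure P {f \<in> space P. f a = y (Suc 0)} * measure H (B 0)"
        unfolding measure_def U_def using arrow(1)[OF Suc.prems(1)] Suc.prems(3)
        by (subst H.emeasure_pair_measure_Times) (auto simp: enn2real_mult)
      then show ?thesis
        using arrow(2)[OF Suc.prems(1)] by simp
    qed
    have split: "E' (Suc n) a y B = {\<omega> \<in> space W. shd \<omega> \<in> U \<and> stl \<omega> \<in> D}"
    proof (rule set_eqI)
      fix \<omega> show "\<omega> \<in> E' (Suc n) a y B \<longleftrightarrow> \<omega> \<in> {\<omega> \<in> space W. shd \<omega> \<in> U \<and> stl \<omega> \<in> D}"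
      proof (cases \<omega>)
        case (SCons x X)
        have sp: "\<omega> \<in> space W \<longleftrightarrow> x \<in> space (P \<Otimes>\<^sub>M H) \<and> X \<in> space W"
          unfolding SCons W_def by (simp add: stream_space_Stream)
        have "(\<forall>i\<le>Suc n. jump_chain a \<omega> i = y i) \<longleftrightarrow>
            (\<forall>i\<le>n. jump_chain (fst x a) X i = y (Suc i))"
          unfolding SCons using Suc.prems(2)
          by (auto simp: less_Suc_eq_le[symmetric] All_less_Suc2 jump_chain_Stream_Suc
                   simp del: jump_chain.simps(2))
        also have "\<dots> \<longleftrightarrow> fst x a = y (Suc 0) \<and>
            (\<forall>i\<le>n. jump_chain (y (Suc 0)) X i = y (Suc i))"
          by (metis jump_chain.simps(1) le0)
        finally have 1: "(\<forall>i\<le>Suc n. jump_chain a \<omega> i = y i) \<longleftrightarrow> \<dots>" .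
        have 2: "(\<forall>i<Suc n. snd (\<omega> !! i) \<in> B i) \<longleftrightarrow>
            snd x \<in> B 0 \<and> (\<forall>i<n. snd (X !! i) \<in> B (Suc i))"
          unfolding SCons by (simp add: All_less_Suc2)
        show ?thesis
          using 1 2 sp unfolding E'_def D_def U_def SCons
          by (cases x) (auto simp: space_pair_measure)
      qed
    qed
    show ?case
    proof (cases "y (Suc 0) \<in> neighbors G a")
      case False
      then have "{f \<in> space P. f a = y (Suc 0)} = {}"
        using Suc.prems(1) unfolding P_def
        by (fastforce simp: space_PiM space_uniform_count_measure PiE_iff)
      then have "E' (Suc n) a y B = {}"
        unfolding split U_def by auto
      then show ?thesis
        using False Suc.prems(2) unfolding prod.lessThan_Suc_shift by simp
    next
      case True
      have Dm: "D \<in> sets W" and mD: "measure W D = (\<Prod>i<n.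
          (if y (Suc (Suc i)) \<in> neighbors G (y (Suc i))
           then 1 / real (card (neighbors G (y (Suc i)))) else 0) * measure H (B (Suc i)))"
        unfolding D_def using Suc.IH[of "y (Suc 0)" "\<lambda>i. y (Suc i)" "\<lambda>i. B (Suc i)"]
          True nb[OF Suc.prems(1)] Suc.prems(3) by auto
      have Em: "E' (Suc n) a y B \<in> sets W"
        using Um Dm unfolding split W_def by measurable
      have "emeasure W (E' (Suc n) a y B) =
          (\<integral>\<^sup>+x. emeasure W {X \<in> space W. x ## X \<in> E' (Suc n) a y B} \<partial>(P \<Otimes>\<^sub>M H))"
        using Em unfolding W_def by (rule S.emeasure_stream_space)
      also have "\<dots> = (\<integral>\<^sup>+x. emeasure W D * indicator U x \<partial>(P \<Otimes>\<^sub>M H))"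
      proof (rule nn_integral_cong)
        fix x assume "x \<in> space (P \<Otimes>\<^sub>M H)"
        then have "{X \<in> space W. x ## X \<in> E' (Suc n) a y B} = (if x \<in> U then D else {})"
          using sets.sets_into_space[OF Dm] unfolding split
          by (auto simp: W_def stream_space_Stream)
        then show "emeasure W {X \<in> space W. x ## X \<in> E' (Suc n) a y B} = emeasure W D * indicator U x"
          by simp
      qed
      also have "\<dots> = emeasure W D * emeasure (P \<Otimes>\<^sub>M H) U"
        using Um by (rule nn_integral_cmult_indicator)
      finally have "measure W (E' (Suc n) a y B) = measure W D * measure (P \<Otimes>\<^sub>M H) U"
        by (simp add: measure_def enn2real_mult)
      then show ?thesis
        using Em Suc.prems(2) unfolding mD mU prod.lessThan_Suc_shift by simp
    qed
  qed
  show "E \<in> sets (walk_measure G)"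
    using main[of a y B n, OF a y0 B] unfolding E_def WW E'_def by blast
  show "measure (walk_measure G) E =
         (\<Prod>i<n. (if y (Suc i) \<in> neighbors G (y i) then 1 / real (card (neighbors G (y i))) else 0) *
                  measure (density lborel (\<lambda>s. ennreal (exponential_density 1 s))) (B i))"
    using main[of a y B n, OF a y0 B] unfolding E_def WW E'_def H_def by blast
qed

end

(*
  A walk of a pair moves first with probability 1/2 (the difference of two independent exponential
  times is an exponential time with random sign), so for each target z the first-passage
  probability q_z(a,b) is harmonic for the pair chain in which a fair coin selects the walk that
  jumps.  By the maximum principle it is determined by its boundary values at a = z or b = z.  In
  the clique with two leaves per vertex, q_z(a,b) depends only on the positions of a and b relative
  to z, and the resulting linear systems are solved by explicit rational functions of k.

  The payoffs that follow are A(u_i,u_j) = 0, A(u_i,leaf of u_i) = p and A(u_i,leaf of u_j) = r for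
  j different from i, with r < 0 < p + (k - 1) r.  Hence the uniform law on the core gains at least
  a fixed positive amount per unit of mass on leaves, and nothing against the core.  An optimal
  strategy loses to nothing, so it puts no mass on leaves; if it missed u_i it would lose -r
  against a leaf at u_i.
*)

theory Submission
  imports Defs
begin

subsection \<open>Holding times and hitting times\<close>

abbreviation holding_measure :: "real measure" where
  "holding_measure \<equiv> density lborel (\<lambda>s. ennreal (exponential_density 1 s))"

lemma prob_space_holding_measure: "prob_space holding_measure"
  by (rule prob_space_exponential_density) simp

text \<open>This is the density at \<open>u\<close> of the difference of two independent mean-one
  exponential times, the Laplace density. Both factors are nonzero exactly for \<open>s\<close> from
  \<open>m = max 0 (- u)\<close> on, where the product is
  \<open>exp (- u) * exp (- 2 * s)\<close>.\<close>

lemma nn_integral_exponential_product: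
  "(\<integral>\<^sup>+s. ennreal (exponential_density 1 (s + u)) * ennreal (exponential_density 1 s) \<partial>lborel)
    = ennreal (exp (- \<bar>u\<bar>) / 2)"
proof -
  define m where "m = max 0 (- u)"
  have "(\<integral>\<^sup>+s. ennreal (exponential_density 1 (s + u)) * ennreal (exponential_density 1 s) \<partial>lborel)
      = (\<integral>\<^sup>+s. ennreal (exp (- u) * exp (- 2 * s)) * indicator {m..} s \<partial>lborel)"
    by (intro nn_integral_cong)
       (auto simp: exponential_density_def m_def ennreal_mult[symmetric] exp_add[symmetric]
             split: split_indicator)
  also have "\<dots> = ennreal (0 - (- (exp (- u) * exp (- 2 * m) / 2)))"
  proof (rule nn_integral_FTC_atLeast)
    show "((\<lambda>x. - (exp (- u) * exp (- 2 * x) / 2)) has_real_derivative exp (- u) * exp (- 2 * x)) (at x)" for x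
      by (auto intro!: derivative_eq_intros)
    have "((\<lambda>x::real. exp (- 2 * x)) \<longlongrightarrow> 0) at_top"
      by real_asymp
    then have "((\<lambda>x. - (exp (- u) * exp (- 2 * x) / 2)) \<longlongrightarrow> - (exp (- u) * 0 / 2)) at_top"
      by (intro tendsto_intros) auto
    then show "((\<lambda>x. - (exp (- u) * exp (- 2 * x) / 2)) \<longlongrightarrow> 0) at_top"
      by simp
  qed auto
  also have "0 - (- (exp (- u) * exp (- 2 * m) / 2)) = exp (- \<bar>u\<bar>) / 2"
    by (auto simp: m_def exp_add[symmetric] max_def)
  finally show ?thesis .
qed

text \<open>The Laplace law is an exponential time with a fair random sign. This is the source of
  the fair coin that decides which of two walks jumps first, and of the memoryless residual time of
  the other one.\<close>

lemma nn_integral_holding_difference: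
  assumes [measurable]: "g \<in> borel_measurable borel"
  shows "(\<integral>\<^sup>+s. \<integral>\<^sup>+t. g (s - t) \<partial>holding_measure \<partial>holding_measure) =
    ennreal (1/2) * (\<integral>\<^sup>+s. g s \<partial>holding_measure) + ennreal (1/2) * (\<integral>\<^sup>+s. g (- s) \<partial>holding_measure)"
proof -
  define e where "e s = ennreal (exponential_density 1 s)" for s
  have [measurable]: "e \<in> borel_measurable borel"
    unfolding e_def by measurable
  have "(\<integral>\<^sup>+s. \<integral>\<^sup>+t. g (s - t) \<partial>density lborel e \<partial>density lborel e) =
      (\<integral>\<^sup>+s. \<integral>\<^sup>+t. e s * (e t * g (s - t)) \<partial>lborel \<partial>lborel)"
    by (simp add: nn_integral_density nn_integral_cmult)
  also have "\<dots> = (\<integral>\<^sup>+t. \<integral>\<^sup>+s. e s * (e t * g (s - t)) \<partial>lborel \<partial>lborel)"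
    by (rule lborel_pair.Fubini') measurable
  also have "\<dots> = (\<integral>\<^sup>+t. \<integral>\<^sup>+u. e (t + u) * (e t * g u) \<partial>lborel \<partial>lborel)"
  proof (rule nn_integral_cong)
    fix t :: real
    show "(\<integral>\<^sup>+s. e s * (e t * g (s - t)) \<partial>lborel) = (\<integral>\<^sup>+u. e (t + u) * (e t * g u) \<partial>lborel)"
      by (subst nn_integral_real_affine[of _ 1 t]) auto
  qed
  also have "\<dots> = (\<integral>\<^sup>+u. \<integral>\<^sup>+t. e (t + u) * (e t * g u) \<partial>lborel \<partial>lborel)"
    by (rule lborel_pair.Fubini') measurable
  also have "\<dots> = (\<integral>\<^sup>+u. (\<integral>\<^sup>+t. e (t + u) * e t \<partial>lborel) * g u \<partial>lborel)"
    by (intro nn_integral_cong) (simp add: mult.assoc[symmetric] nn_integral_multc)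
  also have "\<dots> = (\<integral>\<^sup>+u. ennreal (exp (- \<bar>u\<bar>) / 2) * g u \<partial>lborel)"
    unfolding e_def nn_integral_exponential_product ..
  also have "\<dots> = (\<integral>\<^sup>+u. ennreal (1/2) * (e u * g u) + ennreal (1/2) * (e (- u) * g u) \<partial>lborel)"
  proof (rule nn_integral_cong_AE)
    \<comment> \<open>At \<open>u = 0\<close> both \<open>e u\<close> and \<open>e (- u)\<close>
      equal 1, so the right-hand side counts the point twice; it is a null set.\<close>
    have "AE u in lborel. u \<noteq> (0::real)"
      by (rule AE_lborel_singleton)
    then show "AE u in lborel. ennreal (exp (- \<bar>u\<bar>) / 2) * g u =
        ennreal (1/2) * (e u * g u) + ennreal (1/2) * (e (- u) * g u)"
    proof eventually_elim
      case (elim u)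
      have "e u = (if 0 < u then ennreal (exp (- \<bar>u\<bar>)) else 0)"
           "e (- u) = (if 0 < u then 0 else ennreal (exp (- \<bar>u\<bar>)))"
        using elim by (auto simp: e_def exponential_density_def)
      moreover have "ennreal (exp (- \<bar>u\<bar>) / 2) = ennreal (1/2) * ennreal (exp (- \<bar>u\<bar>))"
        by (subst ennreal_mult[symmetric]) auto
      ultimately show ?case
        by (cases "0 < u") (simp_all add: mult.assoc)
    qed
  qed
  also have "\<dots> = ennreal (1/2) * (\<integral>\<^sup>+u. e u * g u \<partial>lborel) + ennreal (1/2) * (\<integral>\<^sup>+u. e (- u) * g u \<partial>lborel)"
    by (simp add: nn_integral_add nn_integral_cmult)
  also have "(\<integral>\<^sup>+u. e (- u) * g u \<partial>lborel) = (\<integral>\<^sup>+u. e u * g (- u) \<partial>lborel)"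
    by (subst nn_integral_real_affine[of _ "-1" 0]) auto
  finally show ?thesis
    by (simp add: nn_integral_density e_def[symmetric, abs_def])
qed

lemma nn_integral_exp_holding: "(\<integral>\<^sup>+s. ennreal (exp (- s)) \<partial>holding_measure) = ennreal (1/2)"
proof -
  have "(\<integral>\<^sup>+s. ennreal (exp (- s)) \<partial>holding_measure) =
      (\<integral>\<^sup>+s. ennreal (exponential_density 1 (s + 0)) * ennreal (exponential_density 1 s) \<partial>lborel)"
    by (subst nn_integral_density)
       (auto intro!: nn_integral_cong simp: exponential_density_def ennreal_mult[symmetric])
  then show ?thesis
    unfolding nn_integral_exponential_product by simp
qed

lemma AE_holding_pos: "AE s in holding_measure. 0 < s"
proof -
  have "AE s in lborel. s \<noteq> (0::real)"
    by (rule AE_lborel_singleton)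
  then have "AE s in lborel. 0 < ennreal (exponential_density 1 s) \<longrightarrow> 0 < s"
    by eventually_elim (auto simp: exponential_density_def split: if_splits)
  then show ?thesis
    by (simp add: AE_density)
qed

text \<open>The positions at rational times suffice because \<^const>\<open>walk_at\<close> is right-continuous.\<close>

lemma hitting_time_eq_INF_rational:
  "hitting_time z a \<omega> =
    (INF q\<in>{q\<in>\<rat>. 0 \<le> q}. if walk_at a \<omega> q = z then ereal q else \<infinity>)"
proof (rule antisym)
  show "hitting_time z a \<omega> \<le> (INF q\<in>{q\<in>\<rat>. 0 \<le> q}. if walk_at a \<omega> q = z then ereal q else \<infinity>)"
    unfolding hitting_time_def by (intro INF_greatest) (auto intro: INF_lower)
  show "(INF q\<in>{q\<in>\<rat>. 0 \<le> q}. if walk_at a \<omega> q = z then ereal q else \<infinity>) \<le> hitting_time z a \<omega>"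
    (is "?I \<le> _")
    unfolding hitting_time_def
  proof (rule INF_greatest)
    fix t assume t: "t \<in> {t. 0 \<le> t \<and> walk_at a \<omega> t = z}"
    show "?I \<le> ereal t"
    proof (rule dense_ge)
      fix y assume "ereal t < y"
      then obtain r where r: "t < r" "ereal r < y"
        by (metis ereal_dense2 less_ereal.simps(1))
      let ?P = "\<lambda>t n. t < (\<Sum>i\<le>n. snd (\<omega> !! i))"
      \<comment> \<open>The walk stands still on some interval to the right of \<open>t\<close>. If
        no partial sum exceeds \<open>t\<close>, none exceeds a later \<open>q\<close>, so
        \<open>LEAST\<close> is applied to the same empty predicate and returns the same unspecified
        index. Otherwise the least index \<open>N\<close> at \<open>t\<close> remains least until
        the partial sum up to \<open>N\<close> is reached.\<close>
      obtain u where u: "t < u" "u \<le> r" "\<And>q. t \<le> q \<Longrightarrow> q < u \<Longrightarrow> walk_at a \<omega> q = walk_at a \<omega> t"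
      proof (cases "\<exists>n. ?P t n")
        case False
        have c: "walk_at a \<omega> q = walk_at a \<omega> t" if "t \<le> q" for q
        proof -
          have "?P q n \<longleftrightarrow> ?P t n" for n
            using False that by (meson le_less_trans)
          then show ?thesis
            by (simp only: walk_at_def)
        qed
        show thesis
          by (rule that[OF r(1) order.refl]) (erule c)
      next
        case True
        define N where "N = (LEAST n. ?P t n)"
        have N: "?P t N"
          unfolding N_def using True by (rule LeastI_ex)
        have least: "(LEAST n. ?P q n) = N" if "t \<le> q" "?P q N" for q
        proof (rule Least_equality)
          fix m assume "?P q m"
          then have "?P t m" using that by simp
          then show "N \<le> m" unfolding N_def by (rule Least_le)
        qed (use that in simp)
        have c: "walk_at a \<omega> q = walk_at a \<omega> t" if "t \<le> q" "?P q N" for q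
          by (simp only: walk_at_def least[OF that] N_def[symmetric])
        show thesis
        proof (rule that[of "min r (\<Sum>i\<le>N. snd (\<omega> !! i))"])
          fix q assume "t \<le> q" "q < min r (\<Sum>i\<le>N. snd (\<omega> !! i))"
          then show "walk_at a \<omega> q = walk_at a \<omega> t"
            by (intro c) auto
        qed (use N r in auto)
      qed
      obtain q where q: "q \<in> \<rat>" "t < q" "q < u"
        using Rats_dense_in_real u(1) by blast
      then have "walk_at a \<omega> q = z" "0 \<le> q"
        using t u(3)[of q] by auto
      then have "?I \<le> ereal q"
        using q by (intro INF_lower2[of q]) auto
      also have "ereal q \<le> y"
        using q u r by (meson ereal_less_eq(3) less_imp_le less_le_trans order_trans)
      finally show "?I \<le> y" .
    qed
  qed
qed

lemma hitting_time_nonneg: "0 \<le> hitting_time z a \<omega>"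
  unfolding hitting_time_def by (intro INF_greatest) simp

text \<open>Positivity of the holding times is included. Together the two conditions hold almost
  surely, and the second makes the \<open>LEAST\<close> in \<open>walk_at\<close> an attained
  minimum at every time.\<close>

definition nonexplosive :: "(('v \<Rightarrow> 'v) \<times> real) stream \<Rightarrow> bool" where
  "nonexplosive \<omega> \<longleftrightarrow> (\<forall>i. 0 < snd (\<omega> !! i)) \<and> (\<forall>t. \<exists>n. t < (\<Sum>i\<le>n. snd (\<omega> !! i)))"

text \<open>Positivity of the first holding time makes 0 the least index at time 0, so the walk
  really is at its starting point then.\<close>

lemma hitting_time_self:
  assumes "0 < snd (\<omega> !! 0)"
  shows "hitting_time z z \<omega> = 0"
proof (rule antisym)
  have "(LEAST n. 0 < (\<Sum>i\<le>n. snd (\<omega> !! i))) = 0"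
    using assms by (intro Least_equality) auto
  then have "walk_at z \<omega> 0 = z"
    unfolding walk_at_def by simp
  then have "hitting_time z z \<omega> \<le> ereal 0"
    unfolding hitting_time_def by (intro INF_lower) auto
  then show "hitting_time z z \<omega> \<le> 0"
    by (simp add: zero_ereal_def)
qed (rule hitting_time_nonneg)

text \<open>Until time \<open>snd x\<close> the walk sits at \<open>a\<close>, which is not the
  target; afterwards it repeats the walk from \<open>fst x a\<close> along the remaining steps.
  Nonexplosion guarantees that the \<open>LEAST\<close> for the remaining steps is attained, so that
  prepending a step shifts it by exactly one.\<close>

lemma hitting_time_Stream:
  assumes x: "0 < snd x" and \<omega>: "nonexplosive \<omega>" and "a \<noteq> z"
  shows "hitting_time z a (x ## \<omega>) = ereal (snd x) + hitting_time z (fst x a) \<omega>"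
proof -
  let ?s = "snd x"
  have sum: "(\<Sum>i\<le>Suc n. snd ((x ## \<omega>) !! i)) = ?s + (\<Sum>i\<le>n. snd (\<omega> !! i))" for n
    by (subst sum.atMost_Suc_shift) simp
  have before: "walk_at a (x ## \<omega>) t = a" if "t < ?s" for t
  proof -
    have "(LEAST n. t < (\<Sum>i\<le>n. snd ((x ## \<omega>) !! i))) = 0"
      using that by (intro Least_equality) auto
    then show ?thesis
      unfolding walk_at_def by simp
  qed
  have after: "walk_at a (x ## \<omega>) (?s + t) = walk_at (fst x a) \<omega> t" if "0 \<le> t" for t
  proof -
    let ?P = "\<lambda>n. ?s + t < (\<Sum>i\<le>n. snd ((x ## \<omega>) !! i))"
    have P: "?P (Suc n) \<longleftrightarrow> t < (\<Sum>i\<le>n. snd (\<omega> !! i))" for n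
      unfolding sum by simp
    obtain n where "t < (\<Sum>i\<le>n. snd (\<omega> !! i))"
      using \<omega> unfolding nonexplosive_def by blast
    then have "?P (Suc n)" "\<not> ?P 0"
      using P that by auto
    then have "(LEAST n. ?P n) = Suc (LEAST n. ?P (Suc n))"
      by (rule Least_Suc)
    then show ?thesis
      unfolding walk_at_def P by (simp add: jump_chain_Stream_Suc del: jump_chain.simps(2))
  qed
  have "{t. 0 \<le> t \<and> walk_at a (x ## \<omega>) t = z} = (+) ?s ` {t. 0 \<le> t \<and> walk_at (fst x a) \<omega> t = z}"
  proof (intro set_eqI iffI)
    fix t assume t: "t \<in> {t. 0 \<le> t \<and> walk_at a (x ## \<omega>) t = z}"
    then have "?s \<le> t"
      using before[of t] \<open>a \<noteq> z\<close> by force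
    then show "t \<in> (+) ?s ` {t. 0 \<le> t \<and> walk_at (fst x a) \<omega> t = z}"
      using t after[of "t - ?s"] by (intro image_eqI[of _ _ "t - ?s"]) auto
  qed (use after x in auto)
  then have "hitting_time z a (x ## \<omega>) =
      (INF t\<in>{t. 0 \<le> t \<and> walk_at (fst x a) \<omega> t = z}. ereal ?s + ereal t)"
    unfolding hitting_time_def by (simp add: image_image)
  \<comment> \<open>Adding a finite constant commutes with the infimum, also for a target never
    reached, when both sides are infinite.\<close>
  also have "\<dots> = ereal ?s + hitting_time z (fst x a) \<omega>"
    unfolding hitting_time_def
  proof (rule antisym)
    let ?T = "{t. 0 \<le> t \<and> walk_at (fst x a) \<omega> t = z}"
    show "ereal ?s + (INF t\<in>?T. ereal t) \<le> (INF t\<in>?T. ereal ?s + ereal t)"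
      by (intro INF_greatest add_left_mono INF_lower)
    have "(INF t\<in>?T. ereal ?s + ereal t) - ereal ?s \<le> (INF t\<in>?T. ereal t)"
    proof (rule INF_greatest)
      fix t assume "t \<in> ?T"
      then have "(INF t\<in>?T. ereal ?s + ereal t) \<le> ereal ?s + ereal t"
        by (rule INF_lower)
      then show "(INF t\<in>?T. ereal ?s + ereal t) - ereal ?s \<le> ereal t"
        by (simp add: ereal_minus_le_iff add.commute)
    qed
    then show "(INF t\<in>?T. ereal ?s + ereal t) \<le> ereal ?s + (INF t\<in>?T. ereal t)"
      by (simp add: ereal_minus_le_iff add.commute)
  qed
  finally show ?thesis .
qed

subsection \<open>First-step analysis for a pair of walks\<close>

text \<open>The credit of the first walk for a realised pair of hitting times. Values in
  \<open>ennreal\<close> let integrals be exchanged without integrability conditions.\<close>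

definition win_score :: "ereal \<Rightarrow> ereal \<Rightarrow> ennreal" where
  "win_score x y = (if x < y then 1 else if x = y then ennreal (1/2) else 0)"

lemma measurable_win_score[measurable (raw)]:
  assumes [measurable]: "f \<in> borel_measurable M" "g \<in> borel_measurable M"
  shows "(\<lambda>x. win_score (f x) (g x)) \<in> borel_measurable M"
  unfolding win_score_def by measurable

text \<open>Only the difference of two finite delays matters, and a negative delay of one walk is a
  positive delay of the other. Infinite hitting times absorb every finite delay.\<close>

lemma win_score_shift:
  "win_score (ereal s + x) (ereal t + y) = win_score (ereal (s - t) + x) y"
  "win_score (ereal (- t) + x) y = win_score x (ereal t + y)"
  by (cases x; cases y; auto simp: win_score_def)+

lemma win_score_swap: "win_score x y + win_score y x = 1"
proof -
  have "ennreal (1/2) + ennreal (1/2) = 1"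
    by (subst ennreal_plus[symmetric]) simp_all
  then show ?thesis
    unfolding win_score_def by (cases x y rule: linorder_cases) (simp_all add: not_less_iff_gr_or_eq)
qed

lemma nn_integral_cmult_sum:
  assumes "\<And>i. i \<in> I \<Longrightarrow> f i \<in> borel_measurable M"
  shows "(\<integral>\<^sup>+x. c * (\<Sum>i\<in>I. f i x) \<partial>M) = c * (\<Sum>i\<in>I. \<integral>\<^sup>+x. f i x \<partial>M)"
proof -
  have "(\<integral>\<^sup>+x. c * (\<Sum>i\<in>I. f i x) \<partial>M) = c * (\<integral>\<^sup>+x. (\<Sum>i\<in>I. f i x) \<partial>M)"
    by (intro nn_integral_cmult borel_measurable_sum assms)
  then show ?thesis
    using assms by (simp only: nn_integral_sum)
qed

section \<open>Measurability of the walk and its hitting times\<close>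

locale walk_graph =
  fixes G :: "'v pair_pre_digraph"
  assumes finite_pverts: "finite (pverts G)"
    and neighbors: "v \<in> pverts G \<Longrightarrow>
      finite (neighbors G v) \<and> neighbors G v \<noteq> {} \<and> neighbors G v \<subseteq> pverts G"
begin

lemma prob_space_step: "prob_space (step_measure G)"
  using prob_space_step_measure[OF finite_pverts] neighbors by blast

lemma prob_space_walk: "prob_space (walk_measure G)"
  unfolding walk_measure_def by (rule prob_space.prob_space_stream_space[OF prob_space_step])

lemma measurable_snth_walk[measurable]:
  "(\<lambda>\<omega>. \<omega> !! n) \<in> walk_measure G \<rightarrow>\<^sub>M step_measure G"
  unfolding walk_measure_def by measurable

lemma measurable_arrow:
  assumes "v \<in> pverts G"
  shows "(\<lambda>x. fst x v) \<in> step_measure G \<rightarrow>\<^sub>M count_space (neighbors G v)"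
proof -
  have "(\<lambda>f. f v) \<in> (\<Pi>\<^sub>M v\<in>pverts G. uniform_count_measure (neighbors G v)) \<rightarrow>\<^sub>M
      count_space (neighbors G v)"
    using measurable_component_singleton[OF assms, of "\<lambda>v. uniform_count_measure (neighbors G v)"]
    unfolding measurable_cong_sets[OF refl sets_uniform_count_measure_count_space] .
  then show ?thesis
    unfolding step_measure_def by (rule measurable_compose[OF measurable_fst])
qed

lemma measurable_holding[measurable]: "snd \<in> borel_measurable (step_measure G)"
  unfolding step_measure_def by (simp cong: measurable_cong_sets)

text \<open>The arrow read at a step depends on the current position; since there are finitely many
  positions, the measurable single-arrow maps can be glued along them.\<close>

lemma measurable_jump_chain:
  assumes a: "a \<in> pverts G"
  shows "(\<lambda>\<omega>. jump_chain a \<omega> n) \<in> walk_measure G \<rightarrow>\<^sub>M count_space (pverts G)"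
proof (induction n)
  case 0
  then show ?case using a by simp
next
  case (Suc n)
  have "(\<lambda>\<omega>. fst (\<omega> !! n) v) \<in> walk_measure G \<rightarrow>\<^sub>M count_space (pverts G)" if "v \<in> pverts G" for v
  proof -
    have "(\<lambda>w. w) \<in> count_space (neighbors G v) \<rightarrow>\<^sub>M count_space (pverts G)"
      using neighbors[OF that] by auto
    from measurable_compose[OF measurable_arrow[OF that] this]
    show ?thesis
      by (rule measurable_compose[OF measurable_snth_walk])
  qed
  from measurable_compose_countable'[OF this Suc] show ?case
    using finite_pverts by (simp add: countable_finite)
qed

lemma measurable_walk_at:
  assumes a: "a \<in> pverts G"
  shows "(\<lambda>\<omega>. walk_at a \<omega> t) \<in> walk_measure G \<rightarrow>\<^sub>M count_space (pverts G)"
  unfolding walk_at_def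
  by (rule measurable_compose_countable'[OF measurable_jump_chain[OF a], where I=UNIV]) measurable

lemma measurable_hitting_time:
  assumes a: "a \<in> pverts G"
  shows "hitting_time z a \<in> borel_measurable (walk_measure G)"
proof -
  have "(\<lambda>\<omega>. if walk_at a \<omega> q = z then ereal q else \<infinity>) \<in> borel_measurable (walk_measure G)" for q
    by (rule measurable_compose[OF measurable_walk_at[OF a]]) simp
  moreover have "countable {q\<in>\<rat>. 0 \<le> (q::real)}"
    by (rule countable_subset[OF _ countable_rat]) auto
  ultimately show ?thesis
    unfolding hitting_time_eq_INF_rational[abs_def] by (intro borel_measurable_INF)
qed

text \<open>Among the arrows of a step only the one at \<open>a\<close> is read; its marginal is
  uniform on the neighbours of \<open>a\<close> and independent of the holding time.\<close>

lemma nn_integral_step: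
  assumes f: "\<And>v. v \<in> neighbors G a \<Longrightarrow> f v \<in> borel_measurable borel" and a: "a \<in> pverts G"
  shows "(\<integral>\<^sup>+x. f (fst x a) (snd x) \<partial>step_measure G) =
    ennreal (1 / card (neighbors G a)) * (\<Sum>v\<in>neighbors G a. \<integral>\<^sup>+s. f v s \<partial>holding_measure)"
proof -
  define P where "P = (\<Pi>\<^sub>M v\<in>pverts G. uniform_count_measure (neighbors G v))"
  have S: "step_measure G = P \<Otimes>\<^sub>M holding_measure"
    unfolding step_measure_def P_def ..
  interpret H: prob_space holding_measure
    by (rule prob_space_holding_measure)
  have nbp: "prob_space (uniform_count_measure (neighbors G v))" if "v \<in> pverts G" for v
    using neighbors[OF that] by (intro prob_space_uniform_count_measure) auto
  have nb: "finite (neighbors G a)"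
    using neighbors[OF a] by auto
  have Pa: "(\<lambda>g. g a) \<in> P \<rightarrow>\<^sub>M uniform_count_measure (neighbors G a)"
    unfolding P_def using a by (rule measurable_component_singleton)
  have meas: "(\<lambda>x. f (fst x a) (snd x)) \<in> borel_measurable (P \<Otimes>\<^sub>M holding_measure)"
    unfolding S[symmetric]
    by (rule measurable_compose_countable'[OF _ measurable_arrow[OF a]])
       (use nb f in \<open>auto intro: countable_finite measurable_compose[OF measurable_holding]\<close>)
  have "(\<integral>\<^sup>+x. f (fst x a) (snd x) \<partial>step_measure G) = (\<integral>\<^sup>+g. \<integral>\<^sup>+s. f (g a) s \<partial>holding_measure \<partial>P)"
    unfolding S using H.nn_integral_fst[OF meas] by simp
  also have "\<dots> = (\<integral>\<^sup>+v. \<integral>\<^sup>+s. f v s \<partial>holding_measure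
      \<partial>distr P (uniform_count_measure (neighbors G a)) (\<lambda>g. g a))"
    by (subst nn_integral_distr[OF Pa])
       (simp_all add: measurable_cong_sets[OF sets_uniform_count_measure_count_space refl])
  also have "distr P (uniform_count_measure (neighbors G a)) (\<lambda>g. g a) =
      uniform_count_measure (neighbors G a)"
    unfolding P_def using finite_pverts nbp a by (intro distr_PiM_component) auto
  also have "(\<integral>\<^sup>+v. \<integral>\<^sup>+s. f v s \<partial>holding_measure \<partial>uniform_count_measure (neighbors G a)) =
      ennreal (1 / card (neighbors G a)) * (\<Sum>v\<in>neighbors G a. \<integral>\<^sup>+s. f v s \<partial>holding_measure)"
    unfolding uniform_count_measure_def
    by (subst nn_integral_point_measure_finite[OF nb]) (simp_all add: sum_distrib_left)
  finally show ?thesis .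
qed

section \<open>Nonexplosion and the first jump\<close>

lemma AE_snd_pos: "AE x in step_measure G. 0 < snd x"
proof -
  interpret H: prob_space holding_measure
    by (rule prob_space_holding_measure)
  interpret P: prob_space "\<Pi>\<^sub>M v\<in>pverts G. uniform_count_measure (neighbors G v)"
    by (rule prob_space_PiM) (use neighbors in \<open>auto intro!: prob_space_uniform_count_measure\<close>)
  interpret PH: pair_prob_space "\<Pi>\<^sub>M v\<in>pverts G. uniform_count_measure (neighbors G v)" holding_measure ..
  show ?thesis
    unfolding step_measure_def
    by (rule PH.AE_pair_measure, measurable) (simp add: AE_holding_pos)
qed

text \<open>By independence the Laplace transform at 1 of the \<open>n\<close>-th jump time is the
  \<open>n\<close>-th power of that of one holding time, which is 1/2.\<close>

lemma nn_integral_exp_jump_time: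
  assumes a: "a \<in> pverts G"
  shows "(\<integral>\<^sup>+\<omega>. ennreal (exp (- (\<Sum>i<n. snd (\<omega> !! i)))) \<partial>walk_measure G) = ennreal ((1/2) ^ n)"
proof (induction n)
  case 0
  show ?case
    using prob_space.emeasure_space_1[OF prob_space_walk] by simp
next
  case (Suc n)
  interpret S: prob_space "step_measure G" by (rule prob_space_step)
  have nb: "finite (neighbors G a)" "neighbors G a \<noteq> {}"
    using neighbors[OF a] by auto
  have "(\<integral>\<^sup>+\<omega>. ennreal (exp (- (\<Sum>i<Suc n. snd (\<omega> !! i)))) \<partial>walk_measure G) =
      (\<integral>\<^sup>+x. \<integral>\<^sup>+\<omega>. ennreal (exp (- (\<Sum>i<Suc n. snd ((x ## \<omega>) !! i)))) \<partial>walk_measure G \<partial>step_measure G)"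
    unfolding walk_measure_def by (rule S.nn_integral_stream_space) measurable
  also have "\<dots> = (\<integral>\<^sup>+x. \<integral>\<^sup>+\<omega>. ennreal (exp (- snd x)) * ennreal (exp (- (\<Sum>i<n. snd (\<omega> !! i))))
      \<partial>walk_measure G \<partial>step_measure G)"
    unfolding sum.lessThan_Suc_shift
    by (simp add: ennreal_mult[symmetric] exp_add[symmetric] algebra_simps)
  also have "\<dots> = (\<integral>\<^sup>+x. ennreal (exp (- snd x)) * ennreal ((1/2) ^ n) \<partial>step_measure G)"
    by (subst nn_integral_cmult) (simp_all only: Suc, measurable)
  also have "\<dots> = (\<integral>\<^sup>+x. ennreal (exp (- snd x)) \<partial>step_measure G) * ennreal ((1/2) ^ n)"
    by (rule nn_integral_multc) measurable
  also have "(\<integral>\<^sup>+x. ennreal (exp (- snd x)) \<partial>step_measure G) =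
      ennreal (1 / card (neighbors G a)) * (\<Sum>v\<in>neighbors G a. ennreal (1/2))"
    by (subst nn_integral_step[of a "\<lambda>v s. ennreal (exp (- s))"]) (simp_all only: nn_integral_exp_holding a, measurable)
  also have "\<dots> = ennreal (1/2)"
    using nb by (subst sum_ennreal) (simp_all add: ennreal_mult[symmetric] del: ennreal_half)
  finally show ?case
    by (simp add: ennreal_mult[symmetric] del: ennreal_half)
qed

text \<open>The infimum over \<open>n\<close> of \<open>exp\<close> of minus the \<open>n\<close>-th
  jump time has integral at most \<open>(1/2) ^ n\<close> for every \<open>n\<close>, hence vanishes
  almost surely. This says that the jump times exceed every bound.\<close>

lemma AE_nonexplosive:
  assumes a: "a \<in> pverts G"
  shows "AE \<omega> in walk_measure G. nonexplosive \<omega>"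
proof -
  interpret S: prob_space "step_measure G" by (rule prob_space_step)
  have pos: "AE \<omega> in walk_measure G. \<forall>i. 0 < snd (\<omega> !! i)"
    using S.AE_stream_all[OF _ AE_snd_pos] unfolding walk_measure_def stream_all_def
    by simp
  let ?F = "\<lambda>\<omega>. INF n. ennreal (exp (- (\<Sum>i<n. snd (\<omega> !! i))))"
  have "(\<integral>\<^sup>+\<omega>. ?F \<omega> \<partial>walk_measure G) \<le> ennreal ((1/2) ^ n)" for n
    unfolding nn_integral_exp_jump_time[OF a, symmetric]
    by (intro nn_integral_mono INF_lower) simp
  moreover have "(\<lambda>n. ennreal ((1/2) ^ n)) \<longlonglongrightarrow> ennreal 0"
    by (intro tendsto_ennrealI LIMSEQ_realpow_zero) auto
  ultimately have "(\<integral>\<^sup>+\<omega>. ?F \<omega> \<partial>walk_measure G) \<le> ennreal 0"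
    by (intro LIMSEQ_le_const) auto
  then have "AE \<omega> in walk_measure G. ?F \<omega> = 0"
    by (subst nn_integral_0_iff_AE[symmetric]) auto
  with pos show ?thesis
  proof eventually_elim
    case (elim \<omega>)
    have "\<exists>n. t < (\<Sum>i\<le>n. snd (\<omega> !! i))" for t
    proof -
      have "?F \<omega> < ennreal (exp (- t))"
        using elim by simp
      then obtain n where "t < (\<Sum>i<n. snd (\<omega> !! i))"
        by (auto simp: INF_less_iff ennreal_less_iff)
      also have "\<dots> \<le> (\<Sum>i\<le>n. snd (\<omega> !! i))"
        using elim by (intro sum_mono2) (auto simp: less_imp_le)
      finally show ?thesis ..
    qed
    then show ?case
      using elim by (simp add: nonexplosive_def)
  qed
qed

text \<open>Markov property at the first jump. The test function \<open>\<phi>\<close> is arbitrary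
  so that the rule applies to either walk of a pair, also after the other one has been integrated
  out.\<close>

lemma nn_integral_first_step:
  fixes \<phi> :: "ereal \<Rightarrow> ennreal"
  assumes \<phi>[measurable]: "\<phi> \<in> borel_measurable borel" and a: "a \<in> pverts G" "a \<noteq> z"
  shows "(\<integral>\<^sup>+\<omega>. \<phi> (hitting_time z a \<omega>) \<partial>walk_measure G) =
    ennreal (1 / card (neighbors G a)) * (\<Sum>v\<in>neighbors G a.
      \<integral>\<^sup>+s. \<integral>\<^sup>+\<omega>. \<phi> (ereal s + hitting_time z v \<omega>) \<partial>walk_measure G \<partial>holding_measure)"
proof -
  interpret S: prob_space "step_measure G" by (rule prob_space_step)
  interpret W: prob_space "walk_measure G" by (rule prob_space_walk)
  note measurable_hitting_time[measurable]
  have "(\<integral>\<^sup>+\<omega>. \<phi> (hitting_time z a \<omega>) \<partial>walk_measure G) =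
      (\<integral>\<^sup>+x. \<integral>\<^sup>+\<omega>. \<phi> (hitting_time z a (x ## \<omega>)) \<partial>walk_measure G \<partial>step_measure G)"
    unfolding walk_measure_def
    by (rule S.nn_integral_stream_space)
       (use a measurable_hitting_time[OF a(1), of z] in \<open>simp add: walk_measure_def\<close>)
  also have "\<dots> = (\<integral>\<^sup>+x. \<integral>\<^sup>+\<omega>. \<phi> (ereal (snd x) + hitting_time z (fst x a) \<omega>)
      \<partial>walk_measure G \<partial>step_measure G)"
  proof (rule nn_integral_cong_AE)
    show "AE x in step_measure G. (\<integral>\<^sup>+\<omega>. \<phi> (hitting_time z a (x ## \<omega>)) \<partial>walk_measure G) =
        (\<integral>\<^sup>+\<omega>. \<phi> (ereal (snd x) + hitting_time z (fst x a) \<omega>) \<partial>walk_measure G)"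
      using AE_snd_pos
    proof eventually_elim
      case (elim x)
      then show ?case
        using AE_nonexplosive[OF a(1)]
        by (intro nn_integral_cong_AE) (auto simp: hitting_time_Stream a elim!: eventually_mono)
    qed
  qed
  also have "\<dots> = ennreal (1 / card (neighbors G a)) * (\<Sum>v\<in>neighbors G a.
      \<integral>\<^sup>+s. \<integral>\<^sup>+\<omega>. \<phi> (ereal s + hitting_time z v \<omega>) \<partial>walk_measure G \<partial>holding_measure)"
  proof (rule nn_integral_step[of a "\<lambda>v s. \<integral>\<^sup>+\<omega>. \<phi> (ereal s + hitting_time z v \<omega>) \<partial>walk_measure G"])
    fix v assume "v \<in> neighbors G a"
    then have [measurable]: "hitting_time z v \<in> borel_measurable (walk_measure G)"
      using neighbors[OF a(1)] by (intro measurable_hitting_time) auto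
    show "(\<lambda>s. \<integral>\<^sup>+\<omega>. \<phi> (ereal s + hitting_time z v \<omega>) \<partial>walk_measure G) \<in> borel_measurable borel"
      by measurable
  qed (rule a)
  finally show ?thesis .
qed


section \<open>First-passage probabilities of a pair of walks\<close>

definition win_integral :: "'v \<Rightarrow> 'v \<Rightarrow> 'v \<Rightarrow> ennreal" where
  "win_integral z a b = (\<integral>\<^sup>+\<omega>. \<integral>\<^sup>+\<omega>'. win_score (hitting_time z a \<omega>) (hitting_time z b \<omega>')
     \<partial>walk_measure G \<partial>walk_measure G)"

lemma first_passage_prob_nonneg: "0 \<le> first_passage_prob G z a b"
  unfolding first_passage_prob_def by simp

lemma ennreal_first_passage_prob:
  assumes a: "a \<in> pverts G" and b: "b \<in> pverts G"
  shows "ennreal (first_passage_prob G z a b) = win_integral z a b"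
proof -
  interpret W: prob_space "walk_measure G" by (rule prob_space_walk)
  interpret WW: pair_prob_space "walk_measure G" "walk_measure G" ..
  let ?M = "walk_measure G \<Otimes>\<^sub>M walk_measure G"
  note [measurable] = measurable_hitting_time[OF a] measurable_hitting_time[OF b]
  define L where "L = {p \<in> space ?M. hitting_time z a (fst p) < hitting_time z b (snd p)}"
  define E where "E = {p \<in> space ?M. hitting_time z a (fst p) = hitting_time z b (snd p)}"
  have [measurable]: "L \<in> sets ?M" "E \<in> sets ?M"
    unfolding L_def E_def by measurable
  have "win_integral z a b =
      (\<integral>\<^sup>+p. win_score (hitting_time z a (fst p)) (hitting_time z b (snd p)) \<partial>?M)"
    unfolding win_integral_def by (subst W.nn_integral_fst[symmetric]) simp_all
  also have "\<dots> = (\<integral>\<^sup>+p. indicator L p + ennreal (1/2) * indicator E p \<partial>?M)"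
    by (intro nn_integral_cong) (auto simp: win_score_def L_def E_def)
  also have "\<dots> = emeasure ?M L + ennreal (1/2) * emeasure ?M E"
    by (subst nn_integral_add) (simp_all add: nn_integral_cmult)
  also have "\<dots> = ennreal (measure ?M L + 1/2 * measure ?M E)"
    by (simp add: WW.emeasure_eq_measure ennreal_mult[symmetric] ennreal_plus[symmetric]
        del: ennreal_plus ennreal_half)
  also have "measure ?M L + 1/2 * measure ?M E = first_passage_prob G z a b"
    unfolding first_passage_prob_def L_def E_def
    by (intro arg_cong2[where f="(+)"] arg_cong2[where f="(*)"] arg_cong[where f="measure ?M"] refl) auto
  finally show ?thesis ..
qed

text \<open>The two scores of any outcome add up to 1, and the order of integration may be
  exchanged. For \<open>a = b\<close> the value 1/2 results.\<close>

lemma first_passage_prob_swap: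
  assumes a: "a \<in> pverts G" and b: "b \<in> pverts G"
  shows "first_passage_prob G z a b + first_passage_prob G z b a = 1"
proof -
  interpret W: prob_space "walk_measure G" by (rule prob_space_walk)
  interpret WW: pair_prob_space "walk_measure G" "walk_measure G" ..
  note [measurable] = measurable_hitting_time[OF a] measurable_hitting_time[OF b]
  have "win_integral z b a = (\<integral>\<^sup>+\<omega>. \<integral>\<^sup>+\<omega>'. win_score (hitting_time z b \<omega>') (hitting_time z a \<omega>)
     \<partial>walk_measure G \<partial>walk_measure G)"
    unfolding win_integral_def by (rule WW.Fubini') simp
  then have "win_integral z a b + win_integral z b a =
      (\<integral>\<^sup>+\<omega>. \<integral>\<^sup>+\<omega>'. win_score (hitting_time z a \<omega>) (hitting_time z b \<omega>') +
        win_score (hitting_time z b \<omega>') (hitting_time z a \<omega>) \<partial>walk_measure G \<partial>walk_measure G)"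
    unfolding win_integral_def by (simp add: nn_integral_add)
  also have "\<dots> = 1"
    by (simp add: win_score_swap W.emeasure_space_1)
  finally have "ennreal (first_passage_prob G z a b + first_passage_prob G z b a) = ennreal 1"
    by (simp add: ennreal_first_passage_prob a b first_passage_prob_nonneg)
  then show ?thesis
    by (subst (asm) ennreal_inj) (simp_all add: first_passage_prob_nonneg)
qed

text \<open>The walk from \<open>z\<close> hits at time 0 almost surely, whereas the other one needs
  at least its first holding time, which is positive almost surely.\<close>

lemma first_passage_prob_start:
  assumes z: "z \<in> pverts G" and b: "b \<in> pverts G" "b \<noteq> z"
  shows "first_passage_prob G z z b = 1"
proof -
  interpret W: prob_space "walk_measure G" by (rule prob_space_walk)
  interpret H: prob_space holding_measure by (rule prob_space_holding_measure)
  have nb: "finite (neighbors G b)" "neighbors G b \<noteq> {}"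
    using neighbors[OF b(1)] by auto
  have "win_integral z z b = (\<integral>\<^sup>+\<omega>. \<integral>\<^sup>+\<omega>'. win_score 0 (hitting_time z b \<omega>')
      \<partial>walk_measure G \<partial>walk_measure G)"
    unfolding win_integral_def
  proof (intro nn_integral_cong_AE)
    show "AE \<omega> in walk_measure G. (\<integral>\<^sup>+\<omega>'. win_score (hitting_time z z \<omega>) (hitting_time z b \<omega>') \<partial>walk_measure G)
        = (\<integral>\<^sup>+\<omega>'. win_score 0 (hitting_time z b \<omega>') \<partial>walk_measure G)"
      using AE_nonexplosive[OF z]
      by eventually_elim (simp only: nonexplosive_def hitting_time_self)
  qed
  also have "\<dots> = (\<integral>\<^sup>+\<omega>'. win_score 0 (hitting_time z b \<omega>') \<partial>walk_measure G)"
    by (simp add: W.emeasure_space_1)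
  also have "\<dots> = ennreal (1 / card (neighbors G b)) * (\<Sum>v\<in>neighbors G b.
      \<integral>\<^sup>+s. \<integral>\<^sup>+\<omega>. win_score 0 (ereal s + hitting_time z v \<omega>) \<partial>walk_measure G \<partial>holding_measure)"
    using b by (intro nn_integral_first_step) measurable
  also have "(\<lambda>v. \<integral>\<^sup>+s. \<integral>\<^sup>+\<omega>. win_score 0 (ereal s + hitting_time z v \<omega>) \<partial>walk_measure G \<partial>holding_measure)
      = (\<lambda>v. \<integral>\<^sup>+s. \<integral>\<^sup>+\<omega>. 1 \<partial>walk_measure G \<partial>holding_measure)"
  proof (intro ext nn_integral_cong_AE)
    fix v
    have "0 < ereal s + hitting_time z v \<omega>" if "0 < s" for s \<omega>
      using that hitting_time_nonneg[of z v \<omega>] by (simp add: add_pos_nonneg)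
    then show "AE s in holding_measure. (\<integral>\<^sup>+\<omega>. win_score 0 (ereal s + hitting_time z v \<omega>) \<partial>walk_measure G)
        = (\<integral>\<^sup>+\<omega>. 1 \<partial>walk_measure G)"
      using AE_holding_pos by (auto simp: win_score_def elim!: eventually_mono)
  qed
  also have "ennreal (1 / card (neighbors G b)) * (\<Sum>v\<in>neighbors G b.
      \<integral>\<^sup>+s. \<integral>\<^sup>+\<omega>. 1 \<partial>walk_measure G \<partial>holding_measure) = ennreal 1"
    using nb H.emeasure_space_1 by (simp add: W.emeasure_space_1 ennreal_of_nat_eq_real_of_nat
        ennreal_mult[symmetric] del: ennreal_1)
  finally show ?thesis
    using ennreal_first_passage_prob[OF z b(1)]
    by (metis ennreal_inj first_passage_prob_nonneg zero_le_one)
qed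

text \<open>Both walks are expanded at their first jumps. The score then depends on the two holding
  times only through their difference, which is an exponential time with a fair sign. For either
  sign this exponential time is a fresh holding time of the later walk, so that walk's first step
  can be folded back and it appears as not having moved.\<close>

lemma win_integral_first_step:
  assumes a: "a \<in> pverts G" "a \<noteq> z" and b: "b \<in> pverts G" "b \<noteq> z"
  shows "win_integral z a b =
    ennreal (1/2) * (ennreal (1 / card (neighbors G b)) * (\<Sum>v\<in>neighbors G b. win_integral z a v)) +
    ennreal (1/2) * (ennreal (1 / card (neighbors G a)) * (\<Sum>v\<in>neighbors G a. win_integral z v b))"
proof -
  interpret W: prob_space "walk_measure G" by (rule prob_space_walk)
  interpret H: prob_space holding_measure by (rule prob_space_holding_measure)
  interpret WW: pair_prob_space "walk_measure G" "walk_measure G" ..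
  interpret WH: pair_prob_space "walk_measure G" holding_measure ..
  let ?h = "hitting_time z" and ?W = "walk_measure G" and ?E = holding_measure
  let ?A = "neighbors G a" and ?B = "neighbors G b"
  define p q where "p = ennreal (1 / card ?A)" and "q = ennreal (1 / card ?B)"
  note meas[measurable] = measurable_hitting_time
  have A: "u \<in> pverts G" if "u \<in> ?A" for u using neighbors[OF a(1)] that by auto
  have B: "v \<in> pverts G" if "v \<in> ?B" for v using neighbors[OF b(1)] that by auto
  \<comment> \<open>\<open>K x v\<close> is the mean score of the arrival time \<open>x\<close>
    against a walk that waits once and then continues from \<open>v\<close>. \<open>g u v s\<close>
    is the mean score of walks from \<open>u\<close> and \<open>v\<close> when the first is delayed
    by \<open>s\<close>, or advanced if \<open>s\<close> is negative.\<close>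
  define K where "K x v = (\<integral>\<^sup>+t. \<integral>\<^sup>+\<omega>'. win_score x (ereal t + ?h v \<omega>') \<partial>?W \<partial>?E)" for x v
  define g where "g u v s = (\<integral>\<^sup>+\<omega>. \<integral>\<^sup>+\<omega>'. win_score (ereal s + ?h u \<omega>) (?h v \<omega>') \<partial>?W \<partial>?W)" for u v s
  have K_meas: "(\<lambda>x. K x v) \<in> borel_measurable borel" if [measurable]: "v \<in> pverts G" for v
    unfolding K_def by measurable
  have K_walk: "(\<lambda>\<omega>. K (ereal s + ?h u \<omega>) v) \<in> borel_measurable ?W" "(\<lambda>\<omega>. K (?h u \<omega>) v) \<in> borel_measurable ?W"
    if [measurable]: "u \<in> pverts G" "v \<in> pverts G" for s u v
    by (rule measurable_compose[OF _ K_meas[OF that(2)]], measurable)+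
  have K_holding: "(\<lambda>s. \<integral>\<^sup>+\<omega>. K (ereal s + ?h u \<omega>) v \<partial>?W) \<in> borel_measurable ?E"
    if [measurable]: "u \<in> pverts G" "v \<in> pverts G" for u v
    unfolding K_def by measurable
  have g_meas: "g u v \<in> borel_measurable borel" if [measurable]: "u \<in> pverts G" "v \<in> pverts G" for u v
    unfolding g_def[abs_def] by measurable
  have first_b: "(\<integral>\<^sup>+\<omega>'. win_score x (?h b \<omega>') \<partial>?W) = q * (\<Sum>v\<in>?B. K x v)" for x
    unfolding q_def K_def using b by (intro nn_integral_first_step) measurable
  have first_a: "(\<integral>\<^sup>+\<omega>. \<phi> (?h a \<omega>) \<partial>?W) = p * (\<Sum>u\<in>?A. \<integral>\<^sup>+s. \<integral>\<^sup>+\<omega>. \<phi> (ereal s + ?h u \<omega>) \<partial>?W \<partial>?E)"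
    if "\<phi> \<in> borel_measurable borel" for \<phi> :: "ereal \<Rightarrow> ennreal"
    unfolding p_def using a that by (intro nn_integral_first_step)
  have split: "(\<integral>\<^sup>+s. \<integral>\<^sup>+\<omega>. K (ereal s + ?h u \<omega>) v \<partial>?W \<partial>?E) =
      ennreal (1/2) * (\<integral>\<^sup>+s. g u v s \<partial>?E) + ennreal (1/2) * (\<integral>\<^sup>+s. g u v (- s) \<partial>?E)"
    if [measurable]: "u \<in> pverts G" "v \<in> pverts G" for u v
  proof -
    have "(\<integral>\<^sup>+\<omega>. K (ereal s + ?h u \<omega>) v \<partial>?W) = (\<integral>\<^sup>+t. g u v (s - t) \<partial>?E)" for s
      unfolding K_def g_def win_score_shift by (rule WH.Fubini'[symmetric]) measurable
    then show ?thesis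
      by (simp only: nn_integral_holding_difference[OF g_meas[OF that]])
  qed
  \<comment> \<open>Negative sign: the first walk has reached \<open>u\<close>, and the time left
    delays the second, whose jump from \<open>b\<close> is undone.\<close>
  have right: "q * (\<Sum>v\<in>?B. \<integral>\<^sup>+s. g u v (- s) \<partial>?E) = win_integral z u b" if u[measurable]: "u \<in> pverts G" for u
  proof -
    have eq: "(\<integral>\<^sup>+s. g u v (- s) \<partial>?E) = (\<integral>\<^sup>+\<omega>. K (?h u \<omega>) v \<partial>?W)"
      if [measurable]: "v \<in> pverts G" for v
      unfolding g_def K_def win_score_shift by (rule WH.Fubini') measurable
    have "q * (\<Sum>v\<in>?B. \<integral>\<^sup>+s. g u v (- s) \<partial>?E) = q * (\<Sum>v\<in>?B. \<integral>\<^sup>+\<omega>. K (?h u \<omega>) v \<partial>?W)"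
      by (simp only: eq B cong: sum.cong)
    also have "\<dots> = win_integral z u b"
      unfolding win_integral_def first_b 
      by (rule nn_integral_cmult_sum[symmetric]) (intro K_walk u B)
    finally show ?thesis .
  qed
  \<comment> \<open>Positive sign: the second walk has reached \<open>v\<close>, and the jump of the
    first from \<open>a\<close> is undone.\<close>
  have left: "p * (\<Sum>u\<in>?A. \<integral>\<^sup>+s. g u v s \<partial>?E) = win_integral z a v" if [measurable]: "v \<in> pverts G" for v
    unfolding win_integral_def g_def by (rule first_a[symmetric]) measurable
  have "win_integral z a b = p * (\<Sum>u\<in>?A. \<integral>\<^sup>+s. \<integral>\<^sup>+\<omega>. q * (\<Sum>v\<in>?B. K (ereal s + ?h u \<omega>) v) \<partial>?W \<partial>?E)"
  proof -
    have "(\<lambda>x. q * (\<Sum>v\<in>?B. K x v)) \<in> borel_measurable borel"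
      by (intro borel_measurable_times_ennreal borel_measurable_const borel_measurable_sum K_meas B)
    from first_a[OF this] show ?thesis
      unfolding win_integral_def first_b .
  qed
  also have "\<dots> = p * (\<Sum>u\<in>?A. q * (\<Sum>v\<in>?B. \<integral>\<^sup>+s. \<integral>\<^sup>+\<omega>. K (ereal s + ?h u \<omega>) v \<partial>?W \<partial>?E))"
  proof -
    have "(\<integral>\<^sup>+s. \<integral>\<^sup>+\<omega>. q * (\<Sum>v\<in>?B. K (ereal s + ?h u \<omega>) v) \<partial>?W \<partial>?E) =
        q * (\<Sum>v\<in>?B. \<integral>\<^sup>+s. \<integral>\<^sup>+\<omega>. K (ereal s + ?h u \<omega>) v \<partial>?W \<partial>?E)" if u: "u \<in> pverts G" for u
    proof -
      have "(\<integral>\<^sup>+\<omega>. q * (\<Sum>v\<in>?B. K (ereal s + ?h u \<omega>) v) \<partial>?W) =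
          q * (\<Sum>v\<in>?B. \<integral>\<^sup>+\<omega>. K (ereal s + ?h u \<omega>) v \<partial>?W)" for s
        by (rule nn_integral_cmult_sum) (intro K_walk u B)
      moreover have "(\<integral>\<^sup>+s. q * (\<Sum>v\<in>?B. \<integral>\<^sup>+\<omega>. K (ereal s + ?h u \<omega>) v \<partial>?W) \<partial>?E) =
          q * (\<Sum>v\<in>?B. \<integral>\<^sup>+s. \<integral>\<^sup>+\<omega>. K (ereal s + ?h u \<omega>) v \<partial>?W \<partial>?E)"
        by (rule nn_integral_cmult_sum) (intro K_holding u B)
      ultimately show ?thesis
        by (simp only:)
    qed
    then show ?thesis
      by (simp only: A cong: sum.cong)
  qed
  also have "\<dots> = p * (\<Sum>u\<in>?A. q * (\<Sum>v\<in>?B.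
      ennreal (1/2) * (\<integral>\<^sup>+s. g u v s \<partial>?E) + ennreal (1/2) * (\<integral>\<^sup>+s. g u v (- s) \<partial>?E)))"
    by (simp only: split A B cong: sum.cong)
  also have "\<dots> = ennreal (1/2) * (\<Sum>u\<in>?A. \<Sum>v\<in>?B. p * q * (\<integral>\<^sup>+s. g u v s \<partial>?E)) +
      ennreal (1/2) * (\<Sum>u\<in>?A. \<Sum>v\<in>?B. p * q * (\<integral>\<^sup>+s. g u v (- s) \<partial>?E))"
    by (simp only: sum.distrib distrib_left sum_distrib_left mult_ac)
  also have "(\<Sum>u\<in>?A. \<Sum>v\<in>?B. p * q * (\<integral>\<^sup>+s. g u v s \<partial>?E)) =
      (\<Sum>v\<in>?B. \<Sum>u\<in>?A. p * q * (\<integral>\<^sup>+s. g u v s \<partial>?E))"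
    by (rule sum.swap)
  also have "\<dots> = q * (\<Sum>v\<in>?B. p * (\<Sum>u\<in>?A. \<integral>\<^sup>+s. g u v s \<partial>?E))"
    by (simp only: sum_distrib_left mult_ac)
  also have "\<dots> = q * (\<Sum>v\<in>?B. win_integral z a v)"
    by (simp only: left B cong: sum.cong)
  also have "(\<Sum>u\<in>?A. \<Sum>v\<in>?B. p * q * (\<integral>\<^sup>+s. g u v (- s) \<partial>?E)) =
      p * (\<Sum>u\<in>?A. q * (\<Sum>v\<in>?B. \<integral>\<^sup>+s. g u v (- s) \<partial>?E))"
    by (simp only: sum_distrib_left mult_ac)
  also have "\<dots> = p * (\<Sum>u\<in>?A. win_integral z u b)"
    by (simp only: right A cong: sum.cong)
  finally show ?thesis
    unfolding p_def q_def .
qed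

lemma first_passage_prob_first_step:
  assumes a: "a \<in> pverts G" "a \<noteq> z" and b: "b \<in> pverts G" "b \<noteq> z"
  shows "first_passage_prob G z a b =
    ((\<Sum>v\<in>neighbors G a. first_passage_prob G z v b) / card (neighbors G a) +
     (\<Sum>v\<in>neighbors G b. first_passage_prob G z a v) / card (neighbors G b)) / 2"
proof -
  let ?q = "first_passage_prob G z"
  have A: "u \<in> pverts G" if "u \<in> neighbors G a" for u using neighbors[OF a(1)] that by auto
  have B: "v \<in> pverts G" if "v \<in> neighbors G b" for v using neighbors[OF b(1)] that by auto
  have "ennreal (?q a b) = ennreal (1/2) * (ennreal (1 / card (neighbors G b)) * (\<Sum>v\<in>neighbors G b. ennreal (?q a v))) +
    ennreal (1/2) * (ennreal (1 / card (neighbors G a)) * (\<Sum>v\<in>neighbors G a. ennreal (?q v b)))"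
    using win_integral_first_step[OF a b] A B a b by (simp add: ennreal_first_passage_prob del: ennreal_half)
  also have "\<dots> = ennreal (1/2 * (1 / card (neighbors G b) * (\<Sum>v\<in>neighbors G b. ?q a v)) +
      1/2 * (1 / card (neighbors G a) * (\<Sum>v\<in>neighbors G a. ?q v b)))"
    by (simp add: sum_ennreal first_passage_prob_nonneg sum_nonneg ennreal_mult[symmetric]
        ennreal_plus[symmetric] del: ennreal_plus ennreal_half)
  finally have "?q a b = 1/2 * (1 / card (neighbors G b) * (\<Sum>v\<in>neighbors G b. ?q a v)) +
      1/2 * (1 / card (neighbors G a) * (\<Sum>v\<in>neighbors G a. ?q v b))"
    by (subst (asm) ennreal_inj) (auto intro!: add_nonneg_nonneg divide_nonneg_nonneg sum_nonneg first_passage_prob_nonneg)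
  then show ?thesis
    by (simp add: field_simps)
qed

section \<open>Uniqueness for the harmonic equations\<close>

text \<open>Maximum principle. If the maximum \<open>m\<close> were positive, it could not be
  attained at the boundary, and an average of values at most \<open>m\<close> with one value below
  \<open>m\<close> stays below \<open>m\<close>. Strictness therefore spreads backwards along paths
  to \<open>z\<close> and reaches every pair.\<close>

lemma pair_harmonic_le_0:
  fixes w :: "'v \<Rightarrow> 'v \<Rightarrow> real"
  assumes reach: "\<And>a. a \<in> pverts G \<Longrightarrow> (a, z) \<in> (parcs G)\<^sup>*"
    and bdry: "\<And>a. a \<in> pverts G \<Longrightarrow> w a z = 0" "\<And>b. b \<in> pverts G \<Longrightarrow> w z b = 0"
    and harm: "\<And>a b. a \<in> pverts G \<Longrightarrow> b \<in> pverts G \<Longrightarrow> a \<noteq> z \<Longrightarrow> b \<noteq> z \<Longrightarrow>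
      w a b = ((\<Sum>v\<in>neighbors G a. w v b) / card (neighbors G a) +
        (\<Sum>v\<in>neighbors G b. w a v) / card (neighbors G b)) / 2"
    and a: "a \<in> pverts G" and b: "b \<in> pverts G"
  shows "w a b \<le> 0"
proof (rule ccontr)
  assume pos: "\<not> w a b \<le> 0"
  define R where "R = (\<lambda>(a, b). w a b) ` (pverts G \<times> pverts G)"
  have R: "finite R" "R \<noteq> {}"
    unfolding R_def using finite_pverts a by auto
  define m where "m = Max R"
  have le: "w x y \<le> m" if "x \<in> pverts G" "y \<in> pverts G" for x y
    unfolding m_def using that R by (intro Max_ge) (auto simp: R_def)
  have "0 < m"
    using le[OF a b] pos by simp
  have avg_le: "(\<Sum>v\<in>neighbors G x. f v) / card (neighbors G x) \<le> m"
    if "x \<in> pverts G" "\<And>v. v \<in> neighbors G x \<Longrightarrow> f v \<le> m" for f x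
    using neighbors[OF that(1)] sum_bounded_above[of "neighbors G x" f m] that(2)
    by (simp add: divide_le_eq card_gt_0_iff mult.commute)
  have avg_less: "(\<Sum>v\<in>neighbors G x. f v) / card (neighbors G x) < m"
    if "x \<in> pverts G" "\<And>v. v \<in> neighbors G x \<Longrightarrow> f v \<le> m" "u \<in> neighbors G x" "f u < m" for f x u
  proof -
    have "(\<Sum>v\<in>neighbors G x. f v) < (\<Sum>v\<in>neighbors G x. m)"
      using neighbors[OF that(1)] that by (intro sum_strict_mono_ex1) auto
    then show ?thesis
      using neighbors[OF that(1)] by (simp add: divide_less_eq card_gt_0_iff mult.commute)
  qed
  \<comment> \<open>The path moves only the first coordinate, so the inductive claim has to hold for
    all second coordinates at once.\<close>
  have less: "x \<in> pverts G \<longrightarrow> (\<forall>y\<in>pverts G. w x y < m)" if "(x, z) \<in> (parcs G)\<^sup>*" for x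
    using that
  proof (induction rule: converse_rtrancl_induct)
    case base
    show ?case using bdry \<open>0 < m\<close> by simp
  next
    case (step x x')
    show ?case
    proof (intro impI ballI)
      fix y assume x: "x \<in> pverts G" and y: "y \<in> pverts G"
      have x': "x' \<in> neighbors G x"
        using step by (simp add: neighbors_def)
      show "w x y < m"
      proof (cases "x = z \<or> y = z")
        case True
        then show ?thesis using bdry x y \<open>0 < m\<close> by auto
      next
        case False
        have "(\<Sum>v\<in>neighbors G x. w v y) / card (neighbors G x) < m"
          using x y x' step.IH neighbors[OF x] by (intro avg_less[where u=x'] le) auto
        moreover have "(\<Sum>v\<in>neighbors G y. w x v) / card (neighbors G y) \<le> m"
          using x y neighbors[OF y] by (intro avg_le le) auto
        ultimately show ?thesis
          using harm[OF x y] False by simp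
      qed
    qed
  qed
  have "m \<in> R"
    unfolding m_def using R by (rule Max_in)
  then show False
    using less reach by (fastforce simp: R_def)
qed

text \<open>A proposed solution \<open>g\<close> is certified by its boundary values and the
  first-step equations: the maximum principle applies to the difference from the true probabilities
  with either sign.\<close>

lemma first_passage_prob_eqI:
  fixes g :: "'v \<Rightarrow> 'v \<Rightarrow> real"
  assumes z: "z \<in> pverts G" and reach: "\<And>a. a \<in> pverts G \<Longrightarrow> (a, z) \<in> (parcs G)\<^sup>*"
    and zz: "g z z = 1/2"
    and start: "\<And>b. b \<in> pverts G \<Longrightarrow> b \<noteq> z \<Longrightarrow> g z b = 1 \<and> g b z = 0"
    and harm: "\<And>a b. a \<in> pverts G \<Longrightarrow> b \<in> pverts G \<Longrightarrow> a \<noteq> z \<Longrightarrow> b \<noteq> z \<Longrightarrow>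
      g a b = ((\<Sum>v\<in>neighbors G a. g v b) / card (neighbors G a) +
        (\<Sum>v\<in>neighbors G b. g a v) / card (neighbors G b)) / 2"
    and a: "a \<in> pverts G" and b: "b \<in> pverts G"
  shows "first_passage_prob G z a b = g a b"
proof -
  let ?q = "first_passage_prob G z"
  have zz': "?q z z = 1/2"
    using first_passage_prob_swap[OF z z, of z] by simp
  have start': "?q z b = 1 \<and> ?q b z = 0" if "b \<in> pverts G" "b \<noteq> z" for b
    using first_passage_prob_start[OF z that] first_passage_prob_swap[OF z that(1), of z] by simp
  have bdry: "?q x z = g x z" "?q z x = g z x" if "x \<in> pverts G" for x
    using start[OF that] start'[OF that] zz zz' by (cases "x = z"; simp)+
  have "?q a b - g a b \<le> 0"
  proof (rule pair_harmonic_le_0[OF reach, of "\<lambda>a b. ?q a b - g a b"])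
    show "?q x y - g x y = ((\<Sum>v\<in>neighbors G x. ?q v y - g v y) / card (neighbors G x) +
        (\<Sum>v\<in>neighbors G y. ?q x v - g x v) / card (neighbors G y)) / 2"
      if "x \<in> pverts G" "y \<in> pverts G" "x \<noteq> z" "y \<noteq> z" for x y
      using harm[OF that] first_passage_prob_first_step[OF that(1,3,2,4)]
      by (simp add: sum_subtractf diff_divide_distrib)
  qed (simp_all add: bdry a b)
  moreover have "g a b - ?q a b \<le> 0"
  proof (rule pair_harmonic_le_0[OF reach, of "\<lambda>a b. g a b - ?q a b"])
    show "g x y - ?q x y = ((\<Sum>v\<in>neighbors G x. g v y - ?q v y) / card (neighbors G x) +
        (\<Sum>v\<in>neighbors G y. g x v - ?q x v) / card (neighbors G y)) / 2"
      if "x \<in> pverts G" "y \<in> pverts G" "x \<noteq> z" "y \<noteq> z" for x y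
      using harm[OF that] first_passage_prob_first_step[OF that(1,3,2,4)]
      by (simp add: sum_subtractf diff_divide_distrib)
  qed (simp_all add: bdry a b)
  ultimately show ?thesis by simp
qed

text \<open>The game is symmetric and zero-sum; this turns payoffs of a strategy against core
  vertices into payoffs of core vertices against it.\<close>

lemma centered_payoff_swap:
  assumes "a \<in> pverts G" and "b \<in> pverts G"
  shows "centered_payoff G b a = - centered_payoff G a b"
proof -
  have "payoff G a b + payoff G b a = card (pverts G)"
    unfolding payoff_def sum.distrib[symmetric] by (simp add: first_passage_prob_swap assms)
  then show ?thesis
    unfolding centered_payoff_def by simp
qed

end

subsection \<open>The clique with two leaves per vertex\<close>

text \<open>
  Position of a vertex relative to the target.  For a leaf target, \<open>Stem\<close> is its neighbour, \<open>Twin\<close>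
  the other leaf there, \<open>Far\<close> any other core vertex and \<open>Rim\<close> a leaf at such a vertex.  For a core
  target, \<open>Twin\<close> is a leaf attached to it and \<open>Stem\<close> does not occur.
\<close>

datatype position = Hit | Stem | Twin | Far | Rim

text \<open>
  The tables for core and leaf targets are the solutions of the first-step equations for
  \<open>n = k\<close>, over a common denominator.
\<close>

definition core_den :: "real \<Rightarrow> real" where
  "core_den n = 2 * (n + 3) * (n + 4)"

fun core_num :: "real \<Rightarrow> position \<Rightarrow> position \<Rightarrow> real" where
  "core_num n Twin Far = 2 * (n + 2) * (n + 4)"
| "core_num n Far Twin = 2 * (n + 4)"
| "core_num n Twin Rim = (2 * n + 5) * (n + 4)"
| "core_num n Rim Twin = n + 4"
| "core_num n Far Rim = (n + 5) * (n + 3)"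
| "core_num n Rim Far = (n + 3) * (n + 3)"
| "core_num n x y = (if x = y then core_den n / 2 else if x = Hit then core_den n else 0)"

definition core_race :: "real \<Rightarrow> position \<Rightarrow> position \<Rightarrow> real" where
  "core_race n x y = core_num n x y / core_den n"

definition leaf_den :: "real \<Rightarrow> real" where
  "leaf_den n = 16 * n^4 + 124 * n^3 + 342 * n^2 + 410 * n + 188"

fun leaf_num :: "real \<Rightarrow> position \<Rightarrow> position \<Rightarrow> real" where
  "leaf_num n Stem Twin = 8 * n^4 + 62 * n^3 + 183 * n^2 + 256 * n + 166"
| "leaf_num n Twin Stem = 8 * n^4 + 62 * n^3 + 159 * n^2 + 154 * n + 22"
| "leaf_num n Stem Far = 8 * n^4 + 70 * n^3 + 225 * n^2 + 330 * n + 192"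
| "leaf_num n Far Stem = 8 * n^4 + 54 * n^3 + 117 * n^2 + 80 * n - 4"
| "leaf_num n Stem Rim = 8 * n^4 + 70 * n^3 + 233 * n^2 + 356 * n + 218"
| "leaf_num n Rim Stem = 8 * n^4 + 54 * n^3 + 109 * n^2 + 54 * n - 30"
| "leaf_num n Far Twin = 8 * n^4 + 54 * n^3 + 125 * n^2 + 114 * n + 44"
| "leaf_num n Twin Far = 8 * n^4 + 70 * n^3 + 217 * n^2 + 296 * n + 144"
| "leaf_num n Rim Twin = 8 * n^4 + 54 * n^3 + 117 * n^2 + 84 * n + 7"
| "leaf_num n Twin Rim = 8 * n^4 + 70 * n^3 + 225 * n^2 + 326 * n + 181"
| "leaf_num n Far Rim = 8 * n^4 + 62 * n^3 + 179 * n^2 + 235 * n + 125"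
| "leaf_num n Rim Far = 8 * n^4 + 62 * n^3 + 163 * n^2 + 175 * n + 63"
| "leaf_num n x y = (if x = y then leaf_den n / 2 else if x = Hit then leaf_den n else 0)"

definition leaf_race :: "real \<Rightarrow> position \<Rightarrow> position \<Rightarrow> real" where
  "leaf_race n x y = leaf_num n x y / leaf_den n"

text \<open>The mean of \<open>f\<close> after one jump; the values at \<open>Hit\<close> (and \<open>Stem\<close>, for a core target) are junk.\<close>

fun core_avg :: "real \<Rightarrow> (position \<Rightarrow> real) \<Rightarrow> position \<Rightarrow> real" where
  "core_avg n f Twin = f Hit"
| "core_avg n f Far = (f Hit + (n - 2) * f Far + 2 * f Rim) / (n + 1)"
| "core_avg n f Rim = f Far"
| "core_avg n f x = f x"

fun leaf_avg :: "real \<Rightarrow> (position \<Rightarrow> real) \<Rightarrow> position \<Rightarrow> real" where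
  "leaf_avg n f Stem = (f Hit + f Twin + (n - 1) * f Far) / (n + 1)"
| "leaf_avg n f Twin = f Stem"
| "leaf_avg n f Far = (f Stem + (n - 2) * f Far + 2 * f Rim) / (n + 1)"
| "leaf_avg n f Rim = f Far"
| "leaf_avg n f Hit = f Hit"

lemma core_den_pos: "0 \<le> n \<Longrightarrow> 0 < core_den n"
  unfolding core_den_def by simp

text \<open>The equations are homogeneous and the entries share one denominator, so numerators
  suffice. Each of the nine pairs of positions gives a polynomial identity once the degree
  \<open>n + 1\<close> is cleared.\<close>

lemma core_num_harmonic:
  assumes n: "0 \<le> n" and "x \<notin> {Hit, Stem}" and "y \<notin> {Hit, Stem}"
  shows "core_num n x y = (core_avg n (\<lambda>u. core_num n u y) x + core_avg n (core_num n x) y) / 2"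
proof -
  have "1 + n \<noteq> 0"
    using n by linarith
  then show ?thesis
    using assms(2,3)
    by (cases x; cases y) (simp_all add: add_divide_distrib[symmetric],
      simp_all add: core_den_def field_simps power_numeral_reduce)
qed

lemma core_avg_divide: "core_avg n (\<lambda>u. f u / d) x = core_avg n f x / d"
  by (cases x) (simp_all add: add_divide_distrib mult.commute)

lemma core_race_harmonic:
  assumes "0 \<le> n" and "x \<notin> {Hit, Stem}" and "y \<notin> {Hit, Stem}"
  shows "core_race n x y = (core_avg n (\<lambda>u. core_race n u y) x + core_avg n (core_race n x) y) / 2"
  unfolding core_race_def core_avg_divide using core_num_harmonic[OF assms]
  by (simp add: add_divide_distrib)

lemma leaf_den_pos: "0 \<le> n \<Longrightarrow> 0 < leaf_den n"
  unfolding leaf_den_def by (intro add_nonneg_pos add_nonneg_nonneg) simp_all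

text \<open>As for core targets, now with sixteen pairs of positions.\<close>

lemma leaf_num_harmonic:
  assumes n: "0 \<le> n" and "x \<noteq> Hit" and "y \<noteq> Hit"
  shows "leaf_num n x y = (leaf_avg n (\<lambda>u. leaf_num n u y) x + leaf_avg n (leaf_num n x) y) / 2"
proof -
  have "1 + n \<noteq> 0"
    using n by linarith
  then show ?thesis
    using assms(2,3)
    by (cases x; cases y) (simp_all add: add_divide_distrib[symmetric],
      simp_all add: leaf_den_def field_simps power_numeral_reduce)
qed

lemma leaf_avg_divide: "leaf_avg n (\<lambda>u. f u / d) x = leaf_avg n f x / d"
  by (cases x) (simp_all add: add_divide_distrib mult.commute)

lemma leaf_race_harmonic:
  assumes "0 \<le> n" and "x \<noteq> Hit" and "y \<noteq> Hit"
  shows "leaf_race n x y = (leaf_avg n (\<lambda>u. leaf_race n u y) x + leaf_avg n (leaf_race n x) y) / 2"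
  unfolding leaf_race_def leaf_avg_divide using leaf_num_harmonic[OF assms]
  by (simp add: add_divide_distrib)

section \<open>Signs of the payoffs against leaves\<close>

text \<open>Payoff of a core vertex against a leaf attached to it. In their own cluster the core
  vertex wins itself, loses the opposing leaf and races for the other leaf, which explains
  \<open>- 1/2\<close>; the last term collects the other \<open>n - 1\<close> clusters.\<close>

definition own_leaf_margin :: "real \<Rightarrow> real" where
  "own_leaf_margin n = leaf_race n Stem Twin - 1/2 +
     (n - 1) * (core_race n Far Rim + 2 * leaf_race n Far Rim - 3/2)"

text \<open>Payoff of a core vertex against a leaf attached elsewhere: its own cluster, the cluster
  of the leaf, and \<open>n - 2\<close> further clusters. The constant is the one sure win minus the
  share 3/2 of each of the first two clusters.\<close>

definition other_leaf_margin :: "real \<Rightarrow> real" where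
  "other_leaf_margin n = 2 * leaf_race n Stem Rim + core_race n Far Twin + leaf_race n Far Twin - 2 +
     (n - 2) * (core_race n Far Rim + 2 * leaf_race n Far Rim - 3/2)"

text \<open>Multiplied by the positive denominators, the margin is minus a polynomial whose
  coefficients are all positive.\<close>

lemma other_leaf_margin_neg:
  assumes n: "0 \<le> n"
  shows "other_leaf_margin n < 0"
proof -
  have den: "0 < core_den n" "0 < leaf_den n"
    using n by (simp_all add: core_den_pos leaf_den_pos)
  have "other_leaf_margin n * (core_den n * leaf_den n) =
      2 * leaf_num n Stem Rim * core_den n + core_num n Far Twin * leaf_den n + leaf_num n Far Twin * core_den n -
      2 * core_den n * leaf_den n +
      (n - 2) * (core_num n Far Rim * leaf_den n + 2 * leaf_num n Far Rim * core_den n - 3/2 * core_den n * leaf_den n)"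
    unfolding other_leaf_margin_def core_race_def leaf_race_def using den
    by (simp add: field_simps del: core_num.simps leaf_num.simps)
  also have "\<dots> = - (2 * (n + 2) * (8 * n^4 + 38 * n^3 + 45 * n^2 + 23 * n + 26))"
    by (simp add: core_den_def leaf_den_def field_simps power_numeral_reduce)
  also have "\<dots> < 0"
  proof -
    have "0 < 8 * n^4 + 38 * n^3 + 45 * n^2 + 23 * n + 26"
      using n by (intro add_nonneg_pos add_nonneg_nonneg) simp_all
    then show ?thesis
      using n by simp
  qed
  finally show ?thesis
    using den by (simp add: mult_less_0_iff)
qed

text \<open>For \<open>n = k\<close> this is the total payoff of all core vertices against one leaf:
  the gain of the leaf's own neighbour outweighs the losses of the others.\<close>

lemma leaf_margins_pos:
  assumes n: "1 \<le> n"
  shows "0 < own_leaf_margin n + (n - 1) * other_leaf_margin n"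
proof -
  have den: "0 < core_den n" "0 < leaf_den n"
    using n by (simp_all add: core_den_pos leaf_den_pos)
  \<comment> \<open>For \<open>n\<close> at least 1 the terms \<open>48 * n^4\<close> and
    \<open>177 * n\<close> together already exceed 55.\<close>
  have "0 < 48 * n^4 + 276 * n^3 + 454 * n^2 + 177 * n - 55"
    using n one_le_power[OF n, of 4] zero_le_power[of n 3] zero_le_power[of n 2] by linarith
  then have "0 < 2 * (n + 2) * (48 * n^4 + 276 * n^3 + 454 * n^2 + 177 * n - 55)"
    using n by simp
  also have "\<dots> = leaf_num n Stem Twin * core_den n - 1/2 * core_den n * leaf_den n +
      (n - 1) * (core_num n Far Rim * leaf_den n + 2 * leaf_num n Far Rim * core_den n - 3/2 * core_den n * leaf_den n) +
      (n - 1) * (2 * leaf_num n Stem Rim * core_den n + core_num n Far Twin * leaf_den n + leaf_num n Far Twin * core_den n -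
      2 * core_den n * leaf_den n +
      (n - 2) * (core_num n Far Rim * leaf_den n + 2 * leaf_num n Far Rim * core_den n - 3/2 * core_den n * leaf_den n))"
    by (simp add: core_den_def leaf_den_def field_simps power_numeral_reduce)
  also have "\<dots> = (own_leaf_margin n + (n - 1) * other_leaf_margin n) * (core_den n * leaf_den n)"
    unfolding own_leaf_margin_def other_leaf_margin_def core_race_def leaf_race_def using den
    by (simp add: field_simps del: core_num.simps leaf_num.simps)
  finally show ?thesis
    by (rule zero_less_mult_pos2) (simp add: den)
qed

section \<open>Neighbourhoods and relative positions\<close>

locale two_leaf_clique =
  fixes k :: nat
  assumes k: "2 \<le> k"
begin

abbreviation "G \<equiv> pendant_clique k 2"

lemma pverts_eq: "pverts G = Core ` {1..k} \<union> (\<lambda>i. Leaf i 1) ` {1..k} \<union> (\<lambda>i. Leaf i 2) ` {1..k}"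
proof -
  have "{1..2} = {1, 2::nat}" by auto
  then show ?thesis unfolding pendant_clique_def by auto
qed

lemma pverts_iff:
  "Core i \<in> pverts G \<longleftrightarrow> i \<in> {1..k}"
  "Leaf i j \<in> pverts G \<longleftrightarrow> i \<in> {1..k} \<and> (j = 1 \<or> j = 2)"
  unfolding pverts_eq by auto

lemma sum_pverts:
  "(\<Sum>v\<in>pverts G. f v) = (\<Sum>i\<in>{1..k}. f (Core i) + f (Leaf i 1) + f (Leaf i 2))"
  unfolding pverts_eq by (subst sum.union_disjoint, auto simp: sum.distrib sum.reindex inj_on_def)+

lemma card_pverts: "card (pverts G) = 3 * k"
  using sum_pverts[of "\<lambda>_. 1::nat"] by simp

lemma neighbors_pendant_clique:
  "i \<in> {1..k} \<Longrightarrow> neighbors G (Core i) = insert (Leaf i 1) (insert (Leaf i 2) (Core ` ({1..k} - {i})))"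
  "i \<in> {1..k} \<Longrightarrow> j = 1 \<or> j = 2 \<Longrightarrow> neighbors G (Leaf i j) = {Core i}"
proof -
  have "{1..2} = {1, 2::nat}" by auto
  then show "i \<in> {1..k} \<Longrightarrow> neighbors G (Core i) = insert (Leaf i 1) (insert (Leaf i 2) (Core ` ({1..k} - {i})))"
    "i \<in> {1..k} \<Longrightarrow> j = 1 \<or> j = 2 \<Longrightarrow> neighbors G (Leaf i j) = {Core i}"
    unfolding neighbors_def pendant_clique_def by auto
qed

lemma sum_neighbors_Core:
  assumes "i \<in> {1..k}"
  shows "(\<Sum>v\<in>neighbors G (Core i). f v) = f (Leaf i 1) + (f (Leaf i 2) + (\<Sum>m\<in>{1..k} - {i}. f (Core m)))"
  unfolding neighbors_pendant_clique(1)[OF assms]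
  by (subst sum.insert, simp, force, subst sum.insert, simp, force) (simp add: sum.reindex inj_on_def)

lemma card_neighbors_Core: "i \<in> {1..k} \<Longrightarrow> card (neighbors G (Core i)) = k + 1"
  using sum_neighbors_Core[of i "\<lambda>_. 1::nat"] k by simp

lemma walk_graph_pendant_clique: "walk_graph G"
proof
  show "finite (pverts G)"
    unfolding pverts_eq by simp
  show "finite (neighbors G v) \<and> neighbors G v \<noteq> {} \<and> neighbors G v \<subseteq> pverts G" if "v \<in> pverts G" for v
    using that by (cases v) (auto simp: pverts_iff neighbors_pendant_clique)
qed

lemma pendant_clique_connected:
  assumes "a \<in> pverts G" and "b \<in> pverts G"
  shows "(a, b) \<in> (parcs G)\<^sup>*"
proof -
  have arc: "(v, w) \<in> (parcs G)\<^sup>*" if "w \<in> neighbors G v" for v w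
    using that by (auto simp: neighbors_def)
  have core: "(Core i, Core j) \<in> (parcs G)\<^sup>*" if "i \<in> {1..k}" "j \<in> {1..k}" for i j
    using that by (cases "i = j") (auto intro!: arc simp: neighbors_pendant_clique)
  have leaf: "(Leaf i j, Core i) \<in> (parcs G)\<^sup>* \<and> (Core i, Leaf i j) \<in> (parcs G)\<^sup>*"
    if "Leaf i j \<in> pverts G" for i j
    using that by (auto intro!: arc simp: neighbors_pendant_clique pverts_iff)
  define stem where "stem v = (case v of Core i \<Rightarrow> i | Leaf i j \<Rightarrow> i)" for v
  have "(a, Core (stem a)) \<in> (parcs G)\<^sup>*" "(Core (stem b), b) \<in> (parcs G)\<^sup>*"
    using assms leaf by (cases a; cases b; simp add: stem_def)+
  moreover have "(Core (stem a), Core (stem b)) \<in> (parcs G)\<^sup>*"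
    using assms by (intro core) (auto simp: stem_def pverts_iff split: pendant_vertex.split)
  ultimately show ?thesis
    by (meson rtrancl_trans)
qed

fun core_position :: "nat \<Rightarrow> pendant_vertex \<Rightarrow> position" where
  "core_position c (Core i) = (if i = c then Hit else Far)"
| "core_position c (Leaf i j) = (if i = c then Twin else Rim)"

fun leaf_position :: "nat \<Rightarrow> nat \<Rightarrow> pendant_vertex \<Rightarrow> position" where
  "leaf_position c d (Core i) = (if i = c then Stem else Far)"
| "leaf_position c d (Leaf i j) = (if i = c then (if j = d then Hit else Twin) else Rim)"

lemma sum_off_diagonal:
  fixes f :: "nat \<Rightarrow> real"
  assumes "c \<in> {1..k}" "i \<in> {1..k}" "c \<noteq> i" "\<And>m. m \<noteq> c \<Longrightarrow> m \<noteq> i \<Longrightarrow> f m = K"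
  shows "(\<Sum>m\<in>{1..k} - {i}. f m) = f c + (real k - 2) * K"
proof -
  have "(\<Sum>m\<in>{1..k} - {i}. f m) = f c + (\<Sum>m\<in>{1..k} - {i} - {c}. f m)"
    using assms by (intro sum.remove) auto
  also have "(\<Sum>m\<in>{1..k} - {i} - {c}. f m) = (\<Sum>m\<in>{1..k} - {i} - {c}. K)"
    using assms by (intro sum.cong) auto
  finally show ?thesis
    using assms k by (simp add: of_nat_diff)
qed

text \<open>The positions form a lumping of the walk: the law of the next position depends only on
  the present one. A far core vertex, of degree \<open>k + 1\<close>, sees the target,
  \<open>k - 2\<close> far core vertices and two rim leaves.\<close>

lemma core_position_avg:
  assumes c: "c \<in> {1..k}" and v: "v \<in> pverts G" "v \<noteq> Core c"
  shows "(\<Sum>w\<in>neighbors G v. f (core_position c w)) / card (neighbors G v) = core_avg k f (core_position c v)"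
proof (cases v)
  case (Core i)
  then show ?thesis
    using v sum_off_diagonal[OF c, of i "\<lambda>m. f (core_position c (Core m))" "f Far"]
    by (simp add: pverts_iff sum_neighbors_Core card_neighbors_Core add_ac)
next
  case (Leaf i j)
  then show ?thesis
    using v by (auto simp: pverts_iff neighbors_pendant_clique)
qed

text \<open>The same lumping for a leaf target. The stem sees the target, its twin and
  \<open>k - 1\<close> far core vertices; a far core vertex sees the stem in place of the
  target.\<close>

lemma leaf_position_avg:
  assumes c: "c \<in> {1..k}" and d: "d = 1 \<or> d = 2" and v: "v \<in> pverts G" "v \<noteq> Leaf c d"
  shows "(\<Sum>w\<in>neighbors G v. f (leaf_position c d w)) / card (neighbors G v) = leaf_avg k f (leaf_position c d v)"
proof (cases v)
  case (Core i)
  show ?thesis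
  proof (cases "i = c")
    case True
    have "(\<Sum>m\<in>{1..k} - {c}. f (leaf_position c d (Core m))) = (\<Sum>m\<in>{1..k} - {c}. f Far)"
      by (intro sum.cong) auto
    then show ?thesis
      using c d k by (auto simp: Core True sum_neighbors_Core card_neighbors_Core of_nat_diff add_ac)
  next
    case False
    then show ?thesis
      using v Core sum_off_diagonal[OF c, of i "\<lambda>m. f (leaf_position c d (Core m))" "f Far"]
      by (simp add: pverts_iff sum_neighbors_Core card_neighbors_Core add_ac)
  qed
next
  case (Leaf i j)
  then show ?thesis
    using v by (auto simp: pverts_iff neighbors_pendant_clique)
qed

text \<open>Through the lumping the table inherits the first-step equations on the graph, and
  uniqueness identifies it with the probabilities.\<close>

lemma first_passage_prob_Core:
  assumes c: "c \<in> {1..k}" and "a \<in> pverts G" "b \<in> pverts G"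
  shows "first_passage_prob G (Core c) a b = core_race k (core_position c a) (core_position c b)"
proof (rule walk_graph.first_passage_prob_eqI[OF walk_graph_pendant_clique, where
    g = "\<lambda>a b. core_race k (core_position c a) (core_position c b)"])
  have hit: "core_position c v \<notin> {Hit, Stem}" if "v \<noteq> Core c" for v
    using that by (cases v) auto
  show "core_race k (core_position c (Core c)) (core_position c b) = 1 \<and>
      core_race k (core_position c b) (core_position c (Core c)) = 0" if "b \<noteq> Core c" for b
    using that hit[OF that] core_den_pos[of k] by (cases "core_position c b") (auto simp: core_race_def)
  show "core_race k (core_position c a) (core_position c b) =
     ((\<Sum>v\<in>neighbors G a. core_race k (core_position c v) (core_position c b)) / card (neighbors G a) +
      (\<Sum>v\<in>neighbors G b. core_race k (core_position c a) (core_position c v)) / card (neighbors G b)) / 2"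
    if "a \<in> pverts G" "b \<in> pverts G" "a \<noteq> Core c" "b \<noteq> Core c" for a b
    using core_position_avg[OF c that(1,3), of "\<lambda>u. core_race k u (core_position c b)"]
      core_position_avg[OF c that(2,4), of "core_race k (core_position c a)"]
      core_race_harmonic[OF _ hit[OF that(3)] hit[OF that(4)], of k]
    by simp
qed (use assms core_den_pos[of k] in \<open>simp_all add: pverts_iff pendant_clique_connected core_race_def\<close>)

lemma first_passage_prob_Leaf:
  assumes c: "c \<in> {1..k}" and d: "d = 1 \<or> d = 2" and "a \<in> pverts G" "b \<in> pverts G"
  shows "first_passage_prob G (Leaf c d) a b = leaf_race k (leaf_position c d a) (leaf_position c d b)"
proof (rule walk_graph.first_passage_prob_eqI[OF walk_graph_pendant_clique, where
    g = "\<lambda>a b. leaf_race k (leaf_position c d a) (leaf_position c d b)"])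
  have hit: "leaf_position c d v \<noteq> Hit" if "v \<noteq> Leaf c d" for v
    using that by (cases v) auto
  show "leaf_race k (leaf_position c d (Leaf c d)) (leaf_position c d b) = 1 \<and>
      leaf_race k (leaf_position c d b) (leaf_position c d (Leaf c d)) = 0" if "b \<noteq> Leaf c d" for b
    using that hit[OF that] leaf_den_pos[of k] by (cases "leaf_position c d b") (auto simp: leaf_race_def)
  show "leaf_race k (leaf_position c d a) (leaf_position c d b) =
     ((\<Sum>v\<in>neighbors G a. leaf_race k (leaf_position c d v) (leaf_position c d b)) / card (neighbors G a) +
      (\<Sum>v\<in>neighbors G b. leaf_race k (leaf_position c d a) (leaf_position c d v)) / card (neighbors G b)) / 2"
    if "a \<in> pverts G" "b \<in> pverts G" "a \<noteq> Leaf c d" "b \<noteq> Leaf c d" for a b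
    using leaf_position_avg[OF c d that(1,3), of "\<lambda>u. leaf_race k u (leaf_position c d b)"]
      leaf_position_avg[OF c d that(2,4), of "leaf_race k (leaf_position c d a)"]
      leaf_race_harmonic[OF _ hit[OF that(3)] hit[OF that(4)], of k]
    by simp
qed (use assms leaf_den_pos[of k] in \<open>simp_all add: pverts_iff pendant_clique_connected leaf_race_def\<close>)

section \<open>Payoffs by clusters\<close>

text \<open>Targets are grouped into a core vertex with its two leaves; 3/2 is the share of each
  group in half the number of vertices.\<close>

lemma centered_payoff_eq:
  assumes "a \<in> pverts G" "b \<in> pverts G"
  shows "centered_payoff G a b = (\<Sum>c\<in>{1..k}. core_race k (core_position c a) (core_position c b) +
     leaf_race k (leaf_position c 1 a) (leaf_position c 1 b) +
     leaf_race k (leaf_position c 2 a) (leaf_position c 2 b) - 3 / 2)"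
proof -
  have "payoff G a b = (\<Sum>c\<in>{1..k}. core_race k (core_position c a) (core_position c b) +
     leaf_race k (leaf_position c 1 a) (leaf_position c 1 b) +
     leaf_race k (leaf_position c 2 a) (leaf_position c 2 b))"
    unfolding payoff_def sum_pverts using assms
    by (intro sum.cong refl) (simp only: first_passage_prob_Core first_passage_prob_Leaf simp_thms)
  then show ?thesis
    unfolding centered_payoff_def card_pverts by (simp add: sum_subtractf)
qed

lemma sum_two_exceptions:
  fixes f :: "nat \<Rightarrow> real"
  assumes "i \<in> {1..k}" "m \<in> {1..k}" "i \<noteq> m" "\<And>c. c \<noteq> i \<Longrightarrow> c \<noteq> m \<Longrightarrow> f c = K"
  shows "(\<Sum>c\<in>{1..k}. f c) = f i + f m + (real k - 2) * K"
proof -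
  have "(\<Sum>c\<in>{1..k}. f c) = f i + (\<Sum>c\<in>{1..k} - {i}. f c)"
    using assms by (intro sum.remove) auto
  also have "(\<Sum>c\<in>{1..k} - {i}. f c) = f m + (real k - 2) * K"
    using assms by (intro sum_off_diagonal) auto
  finally show ?thesis by simp
qed

lemma sum_one_exception:
  fixes f :: "nat \<Rightarrow> real"
  assumes "i \<in> {1..k}" "\<And>c. c \<noteq> i \<Longrightarrow> f c = K"
  shows "(\<Sum>c\<in>{1..k}. f c) = f i + (real k - 1) * K"
proof -
  have "(\<Sum>c\<in>{1..k}. f c) = f i + (\<Sum>c\<in>{1..k} - {i}. f c)"
    using assms by (intro sum.remove) auto
  also have "(\<Sum>c\<in>{1..k} - {i}. f c) = (\<Sum>c\<in>{1..k} - {i}. K)"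
    using assms by (intro sum.cong) auto
  finally show ?thesis
    using assms k by (simp add: of_nat_diff)
qed

lemma den_pos: "0 < core_den k" "0 < leaf_den k"
  by (simp_all add: core_den_pos leaf_den_pos)

lemma race_simps [simp]:
  "core_race k Hit Far = 1" "core_race k Hit Twin = 1" "core_race k Hit Rim = 1" "core_race k Far Hit = 0"
  "core_race k x x = 1/2" "leaf_race k x x = 1/2" "leaf_race k Stem Hit = 0" "leaf_race k Far Hit = 0"
  using den_pos by (cases x; simp add: core_race_def leaf_race_def)+

text \<open>Targets outside the two clusters are ties. In the two clusters the contributions cancel,
  since the race between \<open>Stem\<close> and \<open>Far\<close> and its reverse have total
  probability 1.\<close>

lemma centered_payoff_Core_Core:
  assumes i: "i \<in> {1..k}" and m: "m \<in> {1..k}"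
  shows "centered_payoff G (Core i) (Core m) = 0"
proof (cases "i = m")
  case False
  have "leaf_race k Stem Far + leaf_race k Far Stem = 1"
    using den_pos by (simp add: leaf_race_def add_divide_distrib[symmetric]) (simp add: leaf_den_def)
  then show ?thesis
    using i m False
    by (subst centered_payoff_eq, simp_all only: pverts_iff)
       (subst sum_two_exceptions[OF i m False, where K=0], simp_all)
qed (use i in \<open>simp add: centered_payoff_eq pverts_iff\<close>)

lemma centered_payoff_own_leaf:
  assumes i: "i \<in> {1..k}" and j: "j = 1 \<or> j = 2"
  shows "centered_payoff G (Core i) (Leaf i j) = own_leaf_margin k"
  using i j
  by (subst centered_payoff_eq, simp_all only: pverts_iff)
     (subst sum_one_exception[OF i, where K="core_race k Far Rim + 2 * leaf_race k Far Rim - 3/2"],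
       auto simp: own_leaf_margin_def)

lemma centered_payoff_other_leaf:
  assumes i: "i \<in> {1..k}" and m: "m \<in> {1..k}" "i \<noteq> m" and j: "j = 1 \<or> j = 2"
  shows "centered_payoff G (Core i) (Leaf m j) = other_leaf_margin k"
  using i m j
  by (subst centered_payoff_eq, simp_all only: pverts_iff)
     (subst sum_two_exceptions[OF i m, where K="core_race k Far Rim + 2 * leaf_race k Far Rim - 3/2"],
       auto simp: other_leaf_margin_def)

section \<open>Optimal strategies\<close>

text \<open>This is \<open>k\<close> times the gain of the uniform core law against a leaf.\<close>

definition leaf_surplus :: real where
  "leaf_surplus = own_leaf_margin k + (real k - 1) * other_leaf_margin k"

lemma leaf_surplus_pos: "0 < leaf_surplus"
  unfolding leaf_surplus_def using k by (intro leaf_margins_pos) simp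

lemma sum_Core_centered_payoff:
  assumes "b \<in> pverts G"
  shows "(\<Sum>i\<in>{1..k}. centered_payoff G (Core i) b) = (if b \<in> Core ` {1..k} then 0 else leaf_surplus)"
proof (cases b)
  case (Core m)
  then show ?thesis
    using assms by (simp add: pverts_iff centered_payoff_Core_Core)
next
  case (Leaf m j)
  then have mj: "m \<in> {1..k}" "j = 1 \<or> j = 2"
    using assms by (simp_all add: pverts_iff)
  have "(\<Sum>i\<in>{1..k}. centered_payoff G (Core i) (Leaf m j)) =
      (\<Sum>i\<in>{1..k}. if i = m then own_leaf_margin k else other_leaf_margin k)"
    using mj by (intro sum.cong) (auto simp: centered_payoff_own_leaf centered_payoff_other_leaf)
  also have "\<dots> = leaf_surplus"
    unfolding leaf_surplus_def by (subst sum_one_exception[OF mj(1), where K="other_leaf_margin k"]) auto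
  finally show ?thesis
    using Leaf by auto
qed

text \<open>The uniform core law ties with every core vertex and gains against every leaf. It also
  shows that the extremal support sizes are taken over a nonempty set.\<close>

lemma optimal_strategies_nonempty: "pmf_of_set (Core ` {1..k}) \<in> optimal_strategies G"
proof -
  let ?\<mu> = "pmf_of_set (Core ` {1..k})"
  have ne: "Core ` {1..k} \<noteq> {}"
    using k by simp
  have card: "card (Core ` {1..k}) = k"
    by (simp add: card_image inj_on_def)
  have "0 \<le> (\<Sum>a\<in>pverts G. pmf ?\<mu> a * centered_payoff G a b)" if b: "b \<in> pverts G" for b
  proof -
    have "(\<Sum>a\<in>pverts G. pmf ?\<mu> a * centered_payoff G a b) =
        (\<Sum>i\<in>{1..k}. 1 / k * centered_payoff G (Core i) b)"
      unfolding sum_pverts using ne card by (intro sum.cong) (auto simp: indicator_def)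
    also have "\<dots> = 1 / k * (\<Sum>i\<in>{1..k}. centered_payoff G (Core i) b)"
      by (rule sum_distrib_left[symmetric])
    also have "0 \<le> \<dots>"
      unfolding sum_Core_centered_payoff[OF b] using leaf_surplus_pos by simp
    finally show ?thesis .
  qed
  then show ?thesis
    using ne by (auto simp: optimal_strategies_def pverts_iff)
qed

lemma set_pmf_optimal_strategy:
  assumes "\<mu> \<in> optimal_strategies G"
  shows "set_pmf \<mu> = Core ` {1..k}"
proof
  interpret walk_graph G
    by (rule walk_graph_pendant_clique)
  have supp: "set_pmf \<mu> \<subseteq> pverts G"
    and opt: "\<And>b. b \<in> pverts G \<Longrightarrow> 0 \<le> (\<Sum>a\<in>pverts G. pmf \<mu> a * centered_payoff G a b)"
    using assms by (auto simp: optimal_strategies_def)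
  let ?t = "\<lambda>a. pmf \<mu> a * (if a \<in> Core ` {1..k} then 0 else leaf_surplus)"
  \<comment> \<open>The optimality conditions at all core vertices are added. By antisymmetry the
    sum equals minus \<open>leaf_surplus\<close> times the mass on leaves, so this mass must be
    zero.\<close>
  have "0 \<le> (\<Sum>i\<in>{1..k}. \<Sum>a\<in>pverts G. pmf \<mu> a * centered_payoff G a (Core i))"
    by (intro sum_nonneg opt) (simp add: pverts_iff)
  also have "\<dots> = (\<Sum>a\<in>pverts G. pmf \<mu> a * (\<Sum>i\<in>{1..k}. centered_payoff G a (Core i)))"
    unfolding sum_distrib_left by (rule sum.swap)
  also have "\<dots> = (\<Sum>a\<in>pverts G. - ?t a)"
  proof (rule sum.cong[OF refl])
    fix a assume a: "a \<in> pverts G"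
    have "(\<Sum>i\<in>{1..k}. centered_payoff G a (Core i)) = - (\<Sum>i\<in>{1..k}. centered_payoff G (Core i) a)"
      unfolding sum_negf[symmetric] using a by (intro sum.cong refl centered_payoff_swap) (simp_all add: pverts_iff)
    then show "pmf \<mu> a * (\<Sum>i\<in>{1..k}. centered_payoff G a (Core i)) = - ?t a"
      unfolding sum_Core_centered_payoff[OF a] by simp
  qed
  finally have "(\<Sum>a\<in>pverts G. ?t a) \<le> 0"
    by (simp add: sum_negf)
  moreover have nonneg: "0 \<le> ?t a" for a
    using leaf_surplus_pos by simp
  ultimately have "(\<Sum>a\<in>pverts G. ?t a) = 0"
    by (intro antisym sum_nonneg)
  then have "?t a = 0" if "a \<in> pverts G" for a
    using that nonneg finite_pverts by (subst (asm) sum_nonneg_eq_0_iff) auto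
  then have leaf_zero: "pmf \<mu> a = 0" if "a \<in> pverts G" "a \<notin> Core ` {1..k}" for a
    using that leaf_surplus_pos by force
  then show "set_pmf \<mu> \<subseteq> Core ` {1..k}"
    using supp unfolding set_pmf_eq by blast
  show "Core ` {1..k} \<subseteq> set_pmf \<mu>"
  proof (rule ccontr)
    assume "\<not> ?thesis"
    then obtain i where i: "i \<in> {1..k}" and zero: "pmf \<mu> (Core i) = 0"
      unfolding set_pmf_eq by blast
    \<comment> \<open>With \<open>Core i\<close> missed as well, all mass lies on the other core
      vertices, each of which has the same negative payoff against a leaf at
      \<open>Core i\<close>.\<close>
    have "(\<Sum>a\<in>pverts G. pmf \<mu> a * centered_payoff G a (Leaf i 1)) =
        (\<Sum>a\<in>pverts G. pmf \<mu> a * other_leaf_margin k)"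
    proof (rule sum.cong[OF refl])
      fix a assume a: "a \<in> pverts G"
      show "pmf \<mu> a * centered_payoff G a (Leaf i 1) = pmf \<mu> a * other_leaf_margin k"
      proof (cases "a \<in> Core ` ({1..k} - {i})")
        case True
        then obtain m where "a = Core m" "m \<in> {1..k}" "m \<noteq> i"
          by blast
        then show ?thesis
          using i by (simp only: centered_payoff_other_leaf simp_thms)
      next
        case False
        then have "pmf \<mu> a = 0"
          using zero leaf_zero[OF a] by blast
        then show ?thesis by simp
      qed
    qed
    also have "\<dots> = other_leaf_margin k"
      using sum_pmf_eq_1[OF finite_pverts supp] by (simp add: sum_distrib_right[symmetric])
    finally show False
      using opt[of "Leaf i 1"] i other_leaf_margin_neg[of k] by (simp add: pverts_iff)
  qed
qed

end

theorem theorem3p1: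
  fixes k :: nat
  assumes "k \<ge> 2"
  shows "card (pverts (pendant_clique k 2)) = 3 * k \<and>
    (\<forall>\<mu>\<in>optimal_strategies (pendant_clique k 2). set_pmf \<mu> = Core ` {1..k}) \<and>
    optimal_strategies (pendant_clique k 2) \<noteq> {} \<and>
    (MIN \<mu>\<in>optimal_strategies (pendant_clique k 2). card (set_pmf \<mu>)) = k \<and>
    (MAX \<mu>\<in>optimal_strategies (pendant_clique k 2). card (set_pmf \<mu>)) = k \<and>
    real k = real (card (pverts (pendant_clique k 2))) / 3"
proof -
  interpret two_leaf_clique k
    using assms by unfold_locales
  have "card (set_pmf \<mu>) = k" if "\<mu> \<in> optimal_strategies G" for \<mu>
    unfolding set_pmf_optimal_strategy[OF that] by (simp add: card_image inj_on_def)
  \<comment> \<open>Minimum and maximum are taken over this singleton of support sizes.\<close>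
  then have "(\<lambda>\<mu>. card (set_pmf \<mu>)) ` optimal_strategies G = {k}"
    using optimal_strategies_nonempty by force
  then show ?thesis
    using set_pmf_optimal_strategy optimal_strategies_nonempty card_pverts by auto
qed

end
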